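(* For each $n\ge 1$, let $f_n(z) = z^n + \xi_{n-1}z^{n-1} + \cdots + \xi_1 z + \xi_0$, where $\xi_0,\xi_1,\ldots$ are independent and identically distributed Rademacher random variables, which take the values $+1$ or $-1$ with equal probability. Then the probability that $f_n$ has a root in $\mathbb{C}$ that is an algebraic number of degree at most $\frac{n^{1/3}}{\log^3 n}$ is at most $O\left(\frac{1}{\sqrt n}\right)$.
   Context: The degree of an algebraic number is the degree of its minimal polynomial over $\mathbb{Q}$. $\log$ is the natural logarithm, $\log^3 n = (\log n)^3$, and the asymptotic notation $O(\cdot)$ is as $n\to\infty$. *)

theory Defs
  imports "HOL-Probability.Probability" "HOL-Computational_Algebra.Computational_Algebra"
begin

definition (in prob_space) rademacher :: "('a \<Rightarrow> real) \<Rightarrow> bool" where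
  "rademacher X \<longleftrightarrow> random_variable borel X \<and>
     prob {\<omega> \<in> space M. X \<omega> = 1} = 1 / 2 \<and> prob {\<omega> \<in> space M. X \<omega> = - 1} = 1 / 2"

definition monic_poly :: "(nat \<Rightarrow> real) \<Rightarrow> nat \<Rightarrow> complex poly" where
  "monic_poly a n = monom 1 n + (\<Sum>i<n. monom (complex_of_real (a i)) i)"

definition rat_annihilates :: "rat poly \<Rightarrow> complex \<Rightarrow> bool" where
  "rat_annihilates p z \<longleftrightarrow> poly (map_poly of_rat p) z = 0"

(* Meaningful only for algebraic z, where the description is uniquely satisfied
   (lemma minimal_poly_exists_unique below). *)
definition minimal_poly :: "complex \<Rightarrow> rat poly" where
  "minimal_poly z = (THE p. lead_coeff p = 1 \<and> rat_annihilates p z \<and>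
     (\<forall>q. q \<noteq> 0 \<longrightarrow> rat_annihilates q z \<longrightarrow> degree p \<le> degree q))"

definition algebraic_degree :: "complex \<Rightarrow> nat" where
  "algebraic_degree z = degree (minimal_poly z)"

lemma rat_annihilates_diff:
  assumes "rat_annihilates p z" "rat_annihilates q z"
  shows "rat_annihilates (p - q) z"
proof -
  have "map_poly of_rat (p - q) = map_poly of_rat p - (map_poly of_rat q :: complex poly)"
    by (rule poly_eqI) (simp add: coeff_map_poly of_rat_diff)
  then show ?thesis using assms by (simp add: rat_annihilates_def)
qed

lemma rat_annihilates_smult:
  assumes "rat_annihilates p z"
  shows "rat_annihilates (smult c p) z"
proof -
  have "map_poly of_rat (smult c p) = smult (of_rat c) (map_poly of_rat p :: complex poly)"
    by (rule poly_eqI) (simp add: coeff_map_poly of_rat_mult)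
  then show ?thesis using assms by (simp add: rat_annihilates_def)
qed

lemma algebraic_iff_rat_annihilates:
  "algebraic z \<longleftrightarrow> (\<exists>p. p \<noteq> 0 \<and> rat_annihilates p z)"
proof
  assume "algebraic z"
  then obtain p where p: "\<And>i. coeff p i \<in> \<rat>" "p \<noteq> 0" "poly p z = 0"
    unfolding algebraic_altdef by blast
  then obtain c where c: "\<And>i. coeff p i = of_rat (c i)"
    unfolding Rats_def image_iff by metis
  have "\<forall>\<^sub>\<infinity>i. c i = 0"
    using MOST_coeff_eq_0[of p] by (simp add: c)
  then have "coeff (Abs_poly c) = c" by (rule Abs_poly_inverse[unfolded mem_Collect_eq])
  then have "map_poly of_rat (Abs_poly c) = p"
    by (intro poly_eqI) (simp add: coeff_map_poly c)
  with p show "\<exists>p. p \<noteq> 0 \<and> rat_annihilates p z"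
    unfolding rat_annihilates_def by (metis map_poly_0)
next
  assume "\<exists>p. p \<noteq> 0 \<and> rat_annihilates p z"
  then obtain p where "p \<noteq> 0" "rat_annihilates p z" by blast
  then show "algebraic z"
    by (intro algebraicI'[of "map_poly of_rat p"])
       (auto simp: rat_annihilates_def coeff_map_poly poly_eq_iff)
qed

lemma minimal_poly_exists_unique:
  assumes "algebraic z"
  shows "\<exists>!p. lead_coeff p = 1 \<and> rat_annihilates p z \<and>
     (\<forall>q. q \<noteq> 0 \<longrightarrow> rat_annihilates q z \<longrightarrow> degree p \<le> degree q)"
proof -
  let ?S = "\<lambda>p. p \<noteq> 0 \<and> rat_annihilates p z"
  obtain p0 where "?S p0" using assms unfolding algebraic_iff_rat_annihilates by blast
  then obtain p where p: "?S p" and min: "\<And>q. ?S q \<Longrightarrow> degree p \<le> degree q"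
    using arg_min_nat_lemma[of ?S p0 degree] by blast
  define m where "m = smult (inverse (lead_coeff p)) p"
  have m: "lead_coeff m = 1" "rat_annihilates m z" "degree m = degree p"
    using p by (auto simp: m_def rat_annihilates_smult)
  show ?thesis
  proof (rule ex1I[of _ m])
    show "lead_coeff m = 1 \<and> rat_annihilates m z \<and>
      (\<forall>q. q \<noteq> 0 \<longrightarrow> rat_annihilates q z \<longrightarrow> degree m \<le> degree q)"
      using m min by simp
  next
    fix r assume r: "lead_coeff r = 1 \<and> rat_annihilates r z \<and>
      (\<forall>q. q \<noteq> 0 \<longrightarrow> rat_annihilates q z \<longrightarrow> degree r \<le> degree q)"
    have "r \<noteq> 0" using r by auto
    then have deg: "degree r = degree m"
      using r m p min[of r] by force
    show "r = m"
    proof (rule ccontr)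
      assume "r \<noteq> m"
      then have nz: "r - m \<noteq> 0" by simp
      have "coeff (r - m) (degree m) = 0" using r m deg by simp
      moreover have "degree (r - m) \<le> degree m" using degree_diff_le[of r "degree m" m] deg by simp
      ultimately have "degree (r - m) < degree m"
        using nz by (metis le_neq_implies_less leading_coeff_0_iff)
      moreover have "degree m \<le> degree (r - m)"
        using min[of "r - m"] nz r m rat_annihilates_diff by simp
      ultimately show False by simp
    qed
  qed
qed

lemma countable_algebraic: "countable {z :: complex. algebraic z}"
proof -
  have "countable (range (Poly :: rat list \<Rightarrow> _))" by simp
  moreover have "range (Poly :: rat list \<Rightarrow> _) = UNIV" by (metis Poly_coeffs surjI)
  ultimately have "countable (UNIV :: rat poly set)" by simp
  then have "countable (UNIV - {0 :: rat poly})" by (rule countable_subset[rotated]) simp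
  moreover have "countable {z. rat_annihilates p z}" if "p \<in> UNIV - {0}" for p
  proof -
    have "map_poly of_rat p \<noteq> (0 :: complex poly)"
      using that by (auto simp: poly_eq_iff coeff_map_poly)
    then show ?thesis
      unfolding rat_annihilates_def by (intro countable_finite poly_roots_finite)
  qed
  ultimately have "countable (\<Union>p\<in>UNIV - {0}. {z. rat_annihilates p z})"
    by (rule countable_UN)
  moreover have "{z. algebraic z} = (\<Union>p\<in>UNIV - {0}. {z. rat_annihilates p z})"
    using algebraic_iff_rat_annihilates by auto
  ultimately show ?thesis by simp
qed

(* The event of the theorem is measurable, so its measure is a genuine probability. *)
lemma (in prob_space) low_degree_root_event:
  fixes \<xi> :: "nat \<Rightarrow> 'a \<Rightarrow> real"
  assumes "\<And>i. random_variable borel (\<xi> i)"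
  shows "{\<omega> \<in> space M. \<exists>z. poly (monic_poly (\<lambda>i. \<xi> i \<omega>) n) z = 0 \<and> algebraic z \<and>
           real (algebraic_degree z) \<le> d} \<in> events"
proof -
  have [measurable]: "\<xi> i \<in> borel_measurable M" for i by (rule assms)
  have "{\<omega> \<in> space M. poly (monic_poly (\<lambda>i. \<xi> i \<omega>) n) z = 0} \<in> events" for z
    unfolding monic_poly_def poly_add poly_sum poly_monom by measurable
  then have "(\<Union>z\<in>{z. algebraic z \<and> real (algebraic_degree z) \<le> d}.
      {\<omega> \<in> space M. poly (monic_poly (\<lambda>i. \<xi> i \<omega>) n) z = 0}) \<in> events"
    by (intro sets.countable_UN' countable_subset[OF _ countable_algebraic]) auto
  also have "(\<Union>z\<in>{z. algebraic z \<and> real (algebraic_degree z) \<le> d}.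
      {\<omega> \<in> space M. poly (monic_poly (\<lambda>i. \<xi> i \<omega>) n) z = 0}) =
    {\<omega> \<in> space M. \<exists>z. poly (monic_poly (\<lambda>i. \<xi> i \<omega>) n) z = 0 \<and> algebraic z \<and>
           real (algebraic_degree z) \<le> d}" by blast
  finally show ?thesis .
qed

end

theory Submission
  imports Defs "HOL-Library.Real_Mod"
begin

text \<open>
  A root of degree \<open>d\<close> is a root of a monic integer factor \<open>g\<close> of \<open>f\<^sub>n\<close> of degree \<open>d\<close>
  with \<open>g(0) = \<plusminus>1\<close> and all roots in \<open>|z| < 2\<close>. Such \<open>g\<close> are counted through the power sums
  \<open>p\<^sub>1, \<dots>, p\<^sub>d\<close> of their roots, which are integers and determine \<open>g\<close>: if all roots have
  modulus at most \<open>\<rho> \<ge> 1\<close>, there are at most \<open>(3 d \<rho>\<^sup>d)\<^sup>d\<close> candidates.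

  If some root \<open>\<alpha>\<close> of \<open>g\<close> has \<open>|\<alpha>| > 1 + 1/d\<close>, then \<open>|\<alpha>\<^sup>d| \<ge> 2\<close>, so \<open>f\<^sub>n(\<alpha>) = 0\<close> determines
  the signs at the multiples of \<open>d\<close> from the others and has probability about \<open>2\<^sup>-\<^sup>n\<^sup>/\<^sup>d\<close>, which beats
  the at most \<open>(3 d 2\<^sup>d)\<^sup>d\<close> candidates. Otherwise there are at most \<open>(9 d)\<^sup>d\<close> candidates, and a
  Halasz-type bound gives that each divides \<open>f\<^sub>n\<close> with probability at most \<open>(2 d / n)\<^sup>d\<^sup>/\<^sup>2\<close>. For this
  bound, divisibility is detected by averaging a character over the linear recurrences modulo \<open>N\<close> with
  characteristic polynomial \<open>g\<close>; as \<open>g(0) = \<plusminus>1\<close>, every window of \<open>d\<close> consecutive terms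
  parametrises these bijectively, and AM-GM over the disjoint windows reduces the average to a single
  one. Both contributions, summed over \<open>d \<le> c n\<^sup>1\<^sup>/\<^sup>3\<close>, are \<open>O(n\<^sup>-\<^sup>1\<^sup>/\<^sup>2)\<close>, the term \<open>d = 1\<close>
  dominating.
\<close>

section \<open>Counting integer polynomials by the size of their roots\<close>

abbreviation cpoly :: "int poly \<Rightarrow> complex poly" where
  "cpoly \<equiv> map_poly of_int"

definition power_sum :: "complex poly \<Rightarrow> nat \<Rightarrow> complex" where
  "power_sum p k = (\<Sum>x\<in>#proots p. x ^ k)"

text \<open>Logarithmic differentiation: a factor \<open>1 - x X\<close> contributes
  \<open>- x / (1 - x X)\<close>, whose \<open>k\<close>-th coefficient is
  \<open>- x ^ Suc k\<close>. Stated without quotients, this goes through by induction on the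
  multiset.\<close>

lemma fps_deriv_prod_linear:
  fixes A :: "complex multiset"
  shows "fps_deriv (\<Prod>x\<in>#A. 1 - fps_const x * fps_X) =
    - (\<Prod>x\<in>#A. 1 - fps_const x * fps_X) * Abs_fps (\<lambda>k. \<Sum>x\<in>#A. x ^ Suc k)"
proof (induction A)
  case empty
  show ?case by (simp add: fps_eq_iff)
next
  case (add x A)
  let ?F = "\<Prod>x\<in>#A. 1 - fps_const x * fps_X" and ?S = "Abs_fps (\<lambda>k. \<Sum>x\<in>#A. x ^ Suc k)"
  let ?G = "Abs_fps (\<lambda>k. x ^ Suc k)"
  have 1: "(1 - fps_const x * fps_X) * ?G = fps_const x"
  proof (rule fps_ext)
    fix n
    have "((1 - fps_const x * fps_X) * ?G) $ n = ?G $ n - x * (fps_X * ?G) $ n"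
      by (simp add: left_diff_distrib mult.assoc)
    then show "((1 - fps_const x * fps_X) * ?G) $ n = fps_const x $ n"
      by (cases n) simp_all
  qed
  have 2: "Abs_fps (\<lambda>k. \<Sum>x\<in>#add_mset x A. x ^ Suc k) = ?G + ?S"
    by (rule fps_ext) simp
  have "fps_deriv (\<Prod>x\<in>#add_mset x A. 1 - fps_const x * fps_X)
      = (1 - fps_const x * fps_X) * (- ?F * ?S) - fps_const x * ?F"
    by (simp only: image_mset_add_mset prod_mset.add_mset fps_deriv_mult add)
      (simp flip: fps_const_neg)
  also have "\<dots> = (1 - fps_const x * fps_X) * (- ?F * ?S) - ((1 - fps_const x * fps_X) * ?G) * ?F"
    by (simp only: 1)
  also have "\<dots> = - ((1 - fps_const x * fps_X) * ?F) * (?G + ?S)"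
    by (simp add: algebra_simps)
  finally show ?case unfolding 2 by simp
qed

text \<open>Reversing the coefficients of \<open>X - x\<close> gives \<open>1 - x X\<close>, and
  reversal is multiplicative, so the factorisation into linear factors carries over.\<close>

lemma fps_of_reflect_poly_monic:
  fixes p :: "complex poly"
  assumes "lead_coeff p = 1"
  shows "fps_of_poly (reflect_poly p) = (\<Prod>x\<in>#proots p. 1 - fps_const x * fps_X)"
proof -
  have "fps_of_poly (reflect_poly (\<Prod>x\<in>#A. [:-x, 1:])) = (\<Prod>x\<in>#A. 1 - fps_const x * fps_X)"
    for A :: "complex multiset"
  proof (induction A)
    case (add x A)
    have "reflect_poly [:-x, 1:] = [:1, -x:]"
      by (simp add: reflect_poly_def cCons_def plus_coeffs.simps)
    then show ?case
      by (simp add: reflect_poly_mult fps_of_poly_mult add.IH fps_of_poly_linear'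
          fps_const_neg[symmetric] del: mult_pCons_left mult_pCons_right fps_const_neg)
  qed simp
  then show ?thesis
    using complex_poly_decompose_multiset[of p] assms by (metis smult_1_left)
qed

text \<open>Compares the coefficients of \<open>X ^ k\<close> in the logarithmic derivative formula.
  Working with the reflected polynomial gives one form of Newton's identities for all
  \<open>k\<close>, including those beyond the degree.\<close>

lemma newton_identity:
  fixes p :: "complex poly"
  assumes "lead_coeff p = 1"
  shows "of_nat (Suc k) * coeff (reflect_poly p) (Suc k)
    = - (\<Sum>i\<le>k. coeff (reflect_poly p) i * power_sum p (Suc (k - i)))"
proof -
  let ?F = "fps_of_poly (reflect_poly p)"
  have "fps_deriv ?F = - ?F * Abs_fps (\<lambda>k. power_sum p (Suc k))"
    unfolding power_sum_def fps_of_reflect_poly_monic[OF assms] by (rule fps_deriv_prod_linear)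
  then have "fps_deriv ?F $ k = (- ?F * Abs_fps (\<lambda>k. power_sum p (Suc k))) $ k" by simp
  then show ?thesis
    by (simp add: fps_mult_nth sum_negf atLeast0AtMost)
qed

text \<open>Newton's identities, divided by \<open>Suc j\<close>, give each reflected coefficient
  from the earlier ones and the power sums. The recursion starts at the leading coefficient
  1.\<close>

lemma monic_eq_of_power_sums:
  fixes p q :: "complex poly"
  assumes "lead_coeff p = 1" "lead_coeff q = 1" "degree p = d" "degree q = d"
    and "\<And>k. k \<in> {1..d} \<Longrightarrow> power_sum p k = power_sum q k"
  shows "p = q"
proof -
  have *: "coeff (reflect_poly p) k = coeff (reflect_poly q) k" if "k \<le> d" for k
    using that
  proof (induction k rule: less_induct)
    case (less k)
    show ?case
    proof (cases k)
      case 0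
      then show ?thesis using assms by simp
    next
      case (Suc j)
      have "(\<Sum>i\<le>j. coeff (reflect_poly p) i * power_sum p (Suc (j - i)))
        = (\<Sum>i\<le>j. coeff (reflect_poly q) i * power_sum q (Suc (j - i)))"
        using less Suc assms(5) by (intro sum.cong refl arg_cong2[where f = "(*)"]) auto
      then have "of_nat (Suc j) * coeff (reflect_poly p) k = of_nat (Suc j) * coeff (reflect_poly q) k"
        using newton_identity assms(1,2) Suc by presburger
      then show ?thesis by (metis mult_cancel_left of_nat_neq_0)
    qed
  qed
  show ?thesis
  proof (rule poly_eqI)
    fix i
    show "coeff p i = coeff q i"
    proof (cases "i \<le> d")
      case True
      then have "d - (d - i) = i" "\<not> d < d - i" by auto
      then show ?thesis using *[of "d - i"] assms(3,4) unfolding coeff_reflect_poly by simp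
    next
      case False
      then show ?thesis using assms(3,4) by (simp add: coeff_eq_0)
    qed
  qed
qed

text \<open>Newton's identities read in the other direction: the term \<open>i = 0\<close> is the
  newest power sum with coefficient 1, so solving for it needs no division.\<close>

lemma power_sum_Ints:
  fixes p :: "complex poly"
  assumes "lead_coeff p = 1" "\<And>i. coeff p i \<in> \<int>"
  shows "power_sum p (Suc k) \<in> \<int>"
proof (induction k rule: less_induct)
  case (less k)
  have E: "coeff (reflect_poly p) i \<in> \<int>" for i
    using assms(2) by (simp add: coeff_reflect_poly)
  have "of_nat (Suc k) * coeff (reflect_poly p) (Suc k) =
      - (power_sum p (Suc k) + (\<Sum>i\<in>{1..k}. coeff (reflect_poly p) i * power_sum p (Suc (k - i))))"
    unfolding newton_identity[OF assms(1)] using assms(1)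
    by (simp add: sum.atLeast_Suc_atMost flip: atLeast0AtMost)
  then have "power_sum p (Suc k) = - (of_nat (Suc k) * coeff (reflect_poly p) (Suc k) +
      (\<Sum>i\<in>{1..k}. coeff (reflect_poly p) i * power_sum p (Suc (k - i))))"
    by (simp add: algebra_simps)
  also have "\<dots> \<in> \<int>"
    using less E by (intro Ints_minus Ints_add Ints_mult Ints_sum) auto
  finally show ?case .
qed

lemma norm_power_sum_le:
  assumes "\<And>z. poly p z = 0 \<Longrightarrow> cmod z \<le> \<rho>"
  shows "cmod (power_sum p k) \<le> real (degree p) * \<rho> ^ k"
proof (cases "p = 0")
  case True
  then show ?thesis by (simp add: power_sum_def)
next
  case False
  have "cmod (\<Sum>x\<in>#A. x ^ k) \<le> real (size A) * \<rho> ^ k" if "\<And>x. x \<in># A \<Longrightarrow> cmod x \<le> \<rho>" for A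
    using that
  proof (induction A)
    case (add x A)
    have "cmod (x ^ k) \<le> \<rho> ^ k"
      using add.prems[of x] by (simp add: norm_power power_mono)
    then show ?case
      using add by (simp add: distrib_right) (smt (verit) norm_triangle_ineq)
  qed simp
  from this[of "proots p"] show ?thesis
    using assms False by (simp add: power_sum_def size_proots_complex)
qed

definition monic_int :: "nat \<Rightarrow> int poly set" where
  "monic_int d = {g. lead_coeff g = 1 \<and> degree g = d}"

lemma coeff_cpoly [simp]: "coeff (cpoly g) i = of_int (coeff g i)"
  by (simp add: coeff_map_poly)

lemma degree_cpoly [simp]: "degree (cpoly g) = degree g"
  by (rule degree_map_poly) simp

lemma cpoly_mult: "cpoly (p * q) = cpoly p * cpoly q"
  by (rule poly_eqI) (simp add: coeff_mult)

text \<open>The tuple of the first \<open>d\<close> power sums determines \<open>g\<close>. Its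
  \<open>k\<close>-th entry is an integer of absolute value at most \<open>d * \<rho> ^ k\<close>,
  so it lies in a finite box whose size bounds the count.\<close>

lemma count_monic_int_bounded_roots:
  assumes "d \<ge> 1" "\<rho> \<ge> 1"
  defines "S \<equiv> {g \<in> monic_int d. \<forall>z. poly (cpoly g) z = 0 \<longrightarrow> cmod z \<le> \<rho>}"
  shows "finite S" "real (card S) \<le> (3 * real d * \<rho> ^ d) ^ d"
proof -
  define B where "B = (\<lambda>k. \<lfloor>real d * \<rho> ^ k\<rfloor>)"
  define T where "T = PiE {1..d} (\<lambda>k. (of_int :: int \<Rightarrow> complex) ` {- B k..B k})"
  define \<Phi> where "\<Phi> = (\<lambda>g. restrict (power_sum (cpoly g)) {1..d})"
  have B0: "B k \<ge> 0" for k
    using assms by (simp add: B_def)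
  have finT: "finite T"
    unfolding T_def by (intro finite_PiE) auto
  have inj: "inj_on \<Phi> S"
  proof (rule inj_onI)
    fix g h assume gh: "g \<in> S" "h \<in> S" "\<Phi> g = \<Phi> h"
    have "power_sum (cpoly g) k = power_sum (cpoly h) k" if "k \<in> {1..d}" for k
      using gh(3) that unfolding \<Phi>_def by (metis restrict_apply')
    then have "cpoly g = cpoly h"
      using gh(1,2) by (intro monic_eq_of_power_sums[of _ _ d]) (auto simp: S_def monic_int_def)
    then show "g = h"
      by (metis coeff_cpoly of_int_eq_iff poly_eqI)
  qed
  have sub: "\<Phi> ` S \<subseteq> T"
  proof
    fix f assume "f \<in> \<Phi> ` S"
    then obtain g where g: "g \<in> S" "f = \<Phi> g" by blast
    have "power_sum (cpoly g) k \<in> of_int ` {- B k..B k}" if k: "k \<in> {1..d}" for k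
    proof -
      have "power_sum (cpoly g) (Suc (k - 1)) \<in> \<int>"
        using g by (intro power_sum_Ints) (auto simp: S_def monic_int_def)
      then obtain a where a: "power_sum (cpoly g) k = of_int a"
        using k by (cases k) (auto elim: Ints_cases)
      have "cmod (power_sum (cpoly g) k) \<le> real d * \<rho> ^ k"
        using norm_power_sum_le[of "cpoly g" \<rho> k] g by (auto simp: S_def monic_int_def)
      then have "\<bar>a\<bar> \<le> B k"
        unfolding a B_def by (simp add: le_floor_iff)
      then show ?thesis unfolding a by (auto intro!: imageI)
    qed
    then show "f \<in> T" by (auto simp: T_def g(2) \<Phi>_def)
  qed
  show "finite S" using inj sub finT by (rule inj_on_finite)
  have "card S \<le> card T" using inj sub finT by (rule card_inj_on_le)
  also have "card T = (\<Prod>k\<in>{1..d}. card ((of_int :: int \<Rightarrow> complex) ` {- B k..B k}))"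
    unfolding T_def by (intro card_PiE) auto
  also have "\<dots> = (\<Prod>k\<in>{1..d}. nat (2 * B k + 1))"
    by (intro prod.cong refl, subst card_image) (auto simp: inj_on_def algebra_simps)
  finally have "real (card S) \<le> (\<Prod>k\<in>{1..d}. real (nat (2 * B k + 1)))"
    by (metis of_nat_le_iff of_nat_prod)
  \<comment> \<open>The summand 1 in \<open>2 * B k + 1\<close> is absorbed because
    \<open>1 \<le> d * \<rho> ^ d\<close>; this yields the factor 3.\<close>
  also have "\<dots> \<le> (\<Prod>k\<in>{1..d}. 3 * real d * \<rho> ^ d)"
  proof (intro prod_mono conjI)
    fix k assume k: "k \<in> {1..d}"
    have 1: "1 \<le> \<rho> ^ d" "\<rho> ^ k \<le> \<rho> ^ d"
      using assms k by (auto intro: power_increasing one_le_power)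
    then have 2: "1 \<le> real d * \<rho> ^ d"
      using assms(1) mult_mono[of 1 "real d" 1 "\<rho> ^ d"] by simp
    have "real_of_int (B k) \<le> real d * \<rho> ^ k"
      unfolding B_def by simp
    also have "\<dots> \<le> real d * \<rho> ^ d" using 1 by (intro mult_left_mono) auto
    finally show "real (nat (2 * B k + 1)) \<le> 3 * real d * \<rho> ^ d"
      using 2 B0[of k] by simp
  qed simp
  finally show "real (card S) \<le> (3 * real d * \<rho> ^ d) ^ d" by simp
qed

section \<open>Divisibility of sign polynomials and linear recurrences\<close>

text \<open>The extensional product fixes the values outside \<open>{..<n}\<close>, so each sign
  pattern has exactly one representative and the set is finite.\<close>

definition signs :: "nat \<Rightarrow> (nat \<Rightarrow> int) set" where
  "signs n = PiE {..<n} (\<lambda>_. {-1, 1})"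

definition sign_poly :: "nat \<Rightarrow> (nat \<Rightarrow> int) \<Rightarrow> int poly" where
  "sign_poly n \<epsilon> = monom 1 n + (\<Sum>i<n. monom (\<epsilon> i) i)"

lemma finite_signs [simp]: "finite (signs n)"
  unfolding signs_def by (intro finite_PiE) auto

lemma signs_mem: "\<epsilon> \<in> signs n \<Longrightarrow> i < n \<Longrightarrow> \<epsilon> i \<in> {-1, 1}"
  using PiE_mem[of \<epsilon> "{..<n}" "\<lambda>_. {-1, 1}" i] by (simp add: signs_def)

lemma signs_eqI:
  "\<epsilon> \<in> signs n \<Longrightarrow> \<delta> \<in> signs n \<Longrightarrow> (\<And>i. i < n \<Longrightarrow> \<epsilon> i = \<delta> i) \<Longrightarrow> \<epsilon> = \<delta>"
  using PiE_ext[of \<epsilon> "{..<n}" "\<lambda>_. {-1, 1}" \<delta>] by (simp add: signs_def)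

lemma coeff_sign_poly:
  "coeff (sign_poly n \<epsilon>) i = (if i < n then \<epsilon> i else if i = n then 1 else 0)"
proof -
  have "coeff (\<Sum>i<n. monom (\<epsilon> i) i) i = (if i < n then \<epsilon> i else 0)"
    by (simp add: coeff_sum sum.delta')
  then show ?thesis by (simp add: sign_poly_def)
qed

lemma degree_sign_poly: "degree (sign_poly n \<epsilon>) = n"
  by (intro antisym degree_le le_degree) (auto simp: coeff_sign_poly)

text \<open>The AM-GM inequality for the numbers \<open>a i ^ card S\<close>.\<close>

lemma prod_le_mean_power:
  fixes a :: "'b \<Rightarrow> real"
  assumes "finite S" "S \<noteq> {}" "\<And>i. i \<in> S \<Longrightarrow> a i \<ge> 0"
  shows "(\<Prod>i\<in>S. a i) \<le> (\<Sum>i\<in>S. a i ^ card S) / card S"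
proof -
  have "(\<Prod>i\<in>S. a i) = (\<Prod>i\<in>S. a i ^ card S) powr (1 / card S)"
  proof -
    have "(\<Prod>i\<in>S. a i) \<ge> 0" by (simp add: prod_nonneg assms)
    moreover have "card S > 0" using assms by (simp add: card_gt_0_iff)
    ultimately show ?thesis
      unfolding prod_power_distrib[symmetric]
      by (cases "prod a S = 0") (simp_all add: powr_powr flip: powr_realpow)
  qed
  also have "\<dots> \<le> (\<Sum>i\<in>S. a i ^ card S / card S)"
    by (rule arith_geom_mean) (use assms in auto)
  finally show ?thesis by (simp add: sum_divide_distrib)
qed

lemma sum_mult_mod_eq:
  fixes c x :: "'b \<Rightarrow> int"
  shows "(\<Sum>i\<in>A. c i * (x i mod k)) mod k = (\<Sum>i\<in>A. c i * x i) mod k"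
proof -
  have "(\<Sum>i\<in>A. c i * (x i mod k)) mod k = (\<Sum>i\<in>A. (c i * (x i mod k)) mod k) mod k"
    by (rule mod_sum_eq[symmetric])
  also have "\<dots> = (\<Sum>i\<in>A. (c i * x i) mod k) mod k"
    by (simp only: mod_mult_right_eq)
  finally show ?thesis by (simp only: mod_sum_eq)
qed

lemma residue_eqI:
  fixes x y k :: int
  assumes "k dvd x - y" "x \<in> {0..<k}" "y \<in> {0..<k}"
  shows "x = y"
  using assms unfolding mod_eq_dvd_iff[symmetric] by (simp add: mod_pos_pos_trivial)

section \<open>Additive characters modulo \<open>N\<close> and moments of the cosine\<close>

definition chr :: "nat \<Rightarrow> int \<Rightarrow> complex" where
  "chr N x = cis (2 * pi * of_int x / of_nat N)"

lemma chr_add: "chr N (x + y) = chr N x * chr N y"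
  by (simp add: chr_def cis_mult distrib_left add_divide_distrib)

lemma chr_0 [simp]: "chr N 0 = 1"
  by (simp add: chr_def)

lemma norm_chr [simp]: "cmod (chr N x) = 1"
  by (simp add: chr_def)

lemma chr_eq_1_iff:
  assumes "N > 0"
  shows "chr N x = 1 \<longleftrightarrow> int N dvd x"
proof -
  have "chr N x = 1 \<longleftrightarrow> (\<exists>k::int. 2 * pi * of_int x / of_nat N = of_int k * (2 * pi))"
    by (simp add: chr_def cis_eq_1_iff)
  also have "\<dots> \<longleftrightarrow> (\<exists>k::int. of_int x = (of_int (int N * k) :: real))"
    using assms by (intro ex_cong1) (auto simp: field_simps)
  also have "\<dots> \<longleftrightarrow> int N dvd x"
    by (auto simp only: of_int_eq_iff dvd_def)
  finally show ?thesis .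
qed

lemma chr_cong:
  assumes "N > 0" "int N dvd x - y"
  shows "chr N x = chr N y"
  using chr_add[of N "x - y" y] chr_eq_1_iff[OF assms(1)] assms(2) by auto

lemma chr_mod: "N > 0 \<Longrightarrow> chr N (x mod int N) = chr N x"
  by (rule chr_cong) (simp_all add: mod_eq_dvd_iff[symmetric])

lemma chr_sum: "chr N (\<Sum>i\<in>A. f i) = (\<Prod>i\<in>A. chr N (f i))"
  by (induction A rule: infinite_finite_induct) (simp_all add: chr_add)

lemma chr_power: "chr N x ^ k = chr N (int k * x)"
  by (induction k) (simp_all add: chr_add distrib_right)

text \<open>The modulus of \<open>chr N (- x) + chr N x\<close>, the factor that one free sign
  contributes to a character sum.\<close>

definition dcos :: "nat \<Rightarrow> int \<Rightarrow> real" where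
  "dcos N x = \<bar>2 * cos (2 * pi * of_int x / of_nat N)\<bar>"

lemma chr_plus_chr_minus: "chr N (- x) + chr N x = of_real (2 * cos (2 * pi * of_int x / of_nat N))"
  by (simp add: chr_def complex_eq_iff)

lemma dcos_nonneg [simp]: "dcos N x \<ge> 0" by (simp add: dcos_def)

lemma dcos_le_2: "dcos N x \<le> 2"
  using abs_cos_le_one[of "2 * pi * of_int x / of_nat N"] by (simp add: dcos_def abs_mult)

lemma sum_chr_mult_eq_0:
  assumes "N > 0" "\<not> int N dvd c"
  shows "(\<Sum>x\<in>{0..<int N}. chr N (x * c)) = 0"
proof -
  have ne: "chr N c \<noteq> 1" using assms chr_eq_1_iff by blast
  have "(\<Sum>x\<in>{0..<int N}. chr N (x * c)) = (\<Sum>k<N. chr N (int k * c))"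
    by (rule sum.reindex_bij_witness[of _ int nat]) auto
  also have "\<dots> = (\<Sum>k<N. chr N c ^ k)"
    by (simp add: chr_power)
  also have "\<dots> = (chr N c ^ N - 1) / (chr N c - 1)"
    using ne by (rule geometric_sum)
  also have "chr N c ^ N = 1"
    unfolding chr_power using assms chr_eq_1_iff by simp
  finally show ?thesis by simp
qed

text \<open>An even exponent removes the absolute value, and the binomial theorem expands the power
  into characters of frequency \<open>2 * (k - h)\<close>. These frequencies have absolute value at
  most \<open>m < N\<close>, so by orthogonality only \<open>k = h\<close> survives.\<close>

lemma sum_dcos_power:
  assumes "N > m" "m = 2 * h"
  shows "(\<Sum>x\<in>{0..<int N}. dcos N x ^ m) = real N * real (m choose h)"
proof -
  have N: "N > 0" using assms by simp
  have "complex_of_real (\<Sum>x\<in>{0..<int N}. dcos N x ^ m)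
      = (\<Sum>x\<in>{0..<int N}. (chr N x + chr N (- x)) ^ m)"
    unfolding dcos_def of_real_sum
    using assms(2) by (intro sum.cong refl) (subst add.commute, simp add: chr_plus_chr_minus power_mult)
  also have "\<dots> = (\<Sum>x\<in>{0..<int N}. \<Sum>k\<le>m. of_nat (m choose k) * chr N (x * (2 * (int k - int h))))"
  proof (intro sum.cong refl)
    fix x
    have "(chr N x + chr N (- x)) ^ m = (\<Sum>k\<le>m. of_nat (m choose k) * (chr N x ^ k * chr N (- x) ^ (m - k)))"
      by (simp add: binomial_ring mult.assoc)
    also have "\<dots> = (\<Sum>k\<le>m. of_nat (m choose k) * chr N (x * (2 * (int k - int h))))"
    proof (intro sum.cong refl arg_cong2[where f = "(*)"])
      fix k assume "k \<in> {..m}"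
      then have "int k * x + int (m - k) * (- x) = x * (2 * (int k - int h))"
        using assms(2) by (simp add: of_nat_diff algebra_simps)
      then show "chr N x ^ k * chr N (- x) ^ (m - k) = chr N (x * (2 * (int k - int h)))"
        unfolding chr_power chr_add[symmetric] by simp
    qed
    finally show "(chr N x + chr N (- x)) ^ m = (\<Sum>k\<le>m. of_nat (m choose k) * chr N (x * (2 * (int k - int h))))" .
  qed
  also have "\<dots> = (\<Sum>k\<le>m. of_nat (m choose k) * (\<Sum>x\<in>{0..<int N}. chr N (x * (2 * (int k - int h)))))"
    by (subst sum.swap) (simp add: sum_distrib_left)
  also have "\<dots> = (\<Sum>k\<in>{h}. of_nat (m choose k) * (\<Sum>x\<in>{0..<int N}. chr N (x * (2 * (int k - int h)))))"
  proof (rule sum.mono_neutral_right)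
    show "\<forall>k\<in>{..m} - {h}. of_nat (m choose k) * (\<Sum>x\<in>{0..<int N}. chr N (x * (2 * (int k - int h)))) = 0"
    proof
      fix k assume k: "k \<in> {..m} - {h}"
      have "\<not> int N dvd 2 * (int k - int h)"
      proof
        assume "int N dvd 2 * (int k - int h)"
        then have "int N \<le> \<bar>2 * (int k - int h)\<bar>"
          using k by (intro zdvd_imp_le) (auto simp: dvd_abs_iff)
        then show False using k assms by auto
      qed
      then show "of_nat (m choose k) * (\<Sum>x\<in>{0..<int N}. chr N (x * (2 * (int k - int h)))) = 0"
        using sum_chr_mult_eq_0[OF N] by simp
    qed
  qed (use assms in auto)
  also have "\<dots> = complex_of_real (real N * real (m choose h))" by simp
  finally show ?thesis by (simp only: of_real_eq_iff)
qed

section \<open>Linear recurrences modulo \<open>N\<close> with characteristic polynomial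
  \<open>g\<close>\<close>

locale linear_recurrence =
  fixes g :: "int poly" and d N :: nat
  assumes deg_g: "degree g = d" and monic_g: "lead_coeff g = 1"
    and unit_g: "\<bar>coeff g 0\<bar> = 1" and d_pos: "d > 0" and N_pos: "N > 0"
begin

definition W :: "(nat \<Rightarrow> int) set" where
  "W = PiE {..<d} (\<lambda>_. {0..<int N})"

text \<open>The companion map: the window of \<open>d\<close> terms moves one place, its first entry
  drops out, and the next term of the recurrence enters at index \<open>d - 1\<close>.\<close>

definition step :: "(nat \<Rightarrow> int) \<Rightarrow> nat \<Rightarrow> int" where
  "step s = restrict (\<lambda>j. if Suc j < d then s (Suc j)
     else (- (\<Sum>i<d. coeff g i * s i)) mod int N) {..<d}"

definition u :: "(nat \<Rightarrow> int) \<Rightarrow> nat \<Rightarrow> int" where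
  "u s i = (step ^^ i) s 0"

definition add :: "(nat \<Rightarrow> int) \<Rightarrow> (nat \<Rightarrow> int) \<Rightarrow> nat \<Rightarrow> int" where
  "add s t = restrict (\<lambda>j. (s j + t j) mod int N) {..<d}"

lemma finite_W: "finite W"
  unfolding W_def by (intro finite_PiE) auto

lemma W_mem: "s \<in> W \<Longrightarrow> j < d \<Longrightarrow> s j \<in> {0..<int N}"
  using PiE_mem[of s "{..<d}" "\<lambda>_. {0..<int N}" j] by (simp add: W_def)

lemma W_eqI: "s \<in> W \<Longrightarrow> t \<in> W \<Longrightarrow> (\<And>j. j < d \<Longrightarrow> s j = t j) \<Longrightarrow> s = t"
  using PiE_ext[of s "{..<d}" "\<lambda>_. {0..<int N}" t] by (simp add: W_def)

lemma card_W: "card W = N ^ d"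
  unfolding W_def by (subst card_PiE) simp_all

lemma inj_on_W_imp_bij: "inj_on f W \<Longrightarrow> (\<And>s. s \<in> W \<Longrightarrow> f s \<in> W) \<Longrightarrow> bij_betw f W W"
  unfolding bij_betw_def by (simp add: endo_inj_surj finite_W image_subsetI)

lemma step_W: "s \<in> W \<Longrightarrow> step s \<in> W"
  using N_pos by (auto simp: W_def step_def PiE_def Pi_def)

lemma add_W: "add s t \<in> W"
  using N_pos by (auto simp: W_def add_def)

text \<open>Equal images agree in all entries but the first, and equality of the appended terms then
  says that \<open>N\<close> divides \<open>coeff g 0 * (t 0 - s 0)\<close>. Here the constant
  coefficient is a unit.\<close>

lemma inj_on_step: "inj_on step W"
proof (rule inj_onI)
  fix s t assume st: "s \<in> W" "t \<in> W" "step s = step t"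
  have tail: "s j = t j" if "0 < j" "j < d" for j
    using fun_cong[OF st(3), of "j - 1"] that by (simp add: step_def less_imp_diff_less)
  have "(- (\<Sum>i<d. coeff g i * s i)) mod int N = (- (\<Sum>i<d. coeff g i * t i)) mod int N"
    using fun_cong[OF st(3), of "d - 1"] d_pos by (simp add: step_def)
  then have "int N dvd (- (\<Sum>i<d. coeff g i * s i)) - (- (\<Sum>i<d. coeff g i * t i))"
    by (simp only: mod_eq_dvd_iff)
  also have "(- (\<Sum>i<d. coeff g i * s i)) - (- (\<Sum>i<d. coeff g i * t i))
      = (\<Sum>i<d. coeff g i * (t i - s i))"
    by (simp add: sum_subtractf right_diff_distrib)
  also have "\<dots> = (\<Sum>i\<in>{0}. coeff g i * (t i - s i))"
    using d_pos tail by (intro sum.mono_neutral_right) auto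
  finally have "int N dvd s 0 - t 0"
    using unit_g by (auto simp: abs_if minus_equation_iff[of "coeff g 0"] dvd_diff_commute split: if_splits)
  moreover have "s 0 \<in> {0..<int N}" "t 0 \<in> {0..<int N}"
    using W_mem st(1,2) d_pos by blast+
  ultimately have "s 0 = t 0"
    by (rule residue_eqI)
  with tail have "s j = t j" if "j < d" for j
    using that by (cases "j = 0") auto
  then show "s = t"
    by (rule W_eqI[OF st(1,2)])
qed

lemma bij_betw_step: "bij_betw step W W"
  using inj_on_step step_W by (rule inj_on_W_imp_bij)

lemma u_window: "j < d \<Longrightarrow> u s (i + j) = (step ^^ i) s j"
proof (induction j arbitrary: i)
  case (Suc j)
  have "(step ^^ i) s (Suc j) = step ((step ^^ i) s) j"
    using Suc.prems by (simp add: step_def)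
  also have "\<dots> = u s (Suc i + j)"
    using Suc.IH[of "Suc i"] Suc.prems by simp
  finally show ?case by simp
qed (simp add: u_def)

lemma u_recurrence: "int N dvd (\<Sum>i\<le>d. coeff g i * u s (k + i))"
proof -
  define t where "t = (step ^^ k) s"
  have "u s (k + d) = u s (Suc k + (d - 1))" using d_pos by simp
  also have "\<dots> = (step ^^ Suc k) s (d - 1)" using d_pos by (intro u_window) simp
  also have "\<dots> = (- (\<Sum>i<d. coeff g i * t i)) mod int N"
    using d_pos by (simp add: t_def step_def)
  also have "(\<Sum>i<d. coeff g i * t i) = (\<Sum>i<d. coeff g i * u s (k + i))"
    by (intro sum.cong refl) (simp add: u_window t_def)
  finally have "u s (k + d) mod int N = (- (\<Sum>i<d. coeff g i * u s (k + i))) mod int N"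
    by simp
  then have "int N dvd u s (k + d) - (- (\<Sum>i<d. coeff g i * u s (k + i)))"
    by (simp only: mod_eq_dvd_iff)
  moreover have "coeff g d = 1" using monic_g deg_g by simp
  ultimately show ?thesis
    by (simp add: lessThan_Suc_atMost[symmetric] add.commute)
qed

lemma step_add: "step (add s t) = add (step s) (step t)"
proof
  fix j
  have "(- (\<Sum>i<d. coeff g i * ((s i + t i) mod int N))) mod int N
      = (- (\<Sum>i<d. coeff g i * (s i + t i))) mod int N"
    by (intro mod_minus_cong sum_mult_mod_eq)
  also have "\<dots> = (- (\<Sum>i<d. coeff g i * s i) + - (\<Sum>i<d. coeff g i * t i)) mod int N"
    by (simp add: distrib_left sum.distrib)
  also have "\<dots> = ((- (\<Sum>i<d. coeff g i * s i)) mod int N + (- (\<Sum>i<d. coeff g i * t i)) mod int N) mod int N"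
    by (rule mod_add_eq[symmetric])
  finally show "step (add s t) j = add (step s) (step t) j"
    by (simp add: step_def add_def)
qed

lemma u_add: "u (add s t) i = (u s i + u t i) mod int N"
proof -
  have "(step ^^ i) (add s t) = add ((step ^^ i) s) ((step ^^ i) t)"
    by (induction i) (simp_all add: step_add)
  then show ?thesis
    using d_pos by (simp add: u_def) (simp add: add_def)
qed

text \<open>A multiple of \<open>g\<close> is an integer combination of the shifts
  \<open>X ^ j * g\<close>, and pairing such a shift with the sequence gives the recurrence at
  position \<open>j\<close>, which vanishes modulo \<open>N\<close>.\<close>

lemma dvd_imp_functional_dvd:
  assumes "g dvd P" "degree P \<le> n" "P \<noteq> 0"
  shows "int N dvd (\<Sum>i\<le>n. coeff P i * u s i)"
proof -
  obtain q where q: "P = g * q" using assms(1) by (elim dvdE)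
  have dq: "degree q + d \<le> n"
    using assms q deg_g by (metis add.commute degree_mult_eq mult_zero_left mult_zero_right)
  have "P = (\<Sum>j\<le>degree q. monom (coeff q j) j * g)"
    by (simp only: q poly_as_sum_of_monoms mult.commute[of g] flip: sum_distrib_right)
  then have "(\<Sum>i\<le>n. coeff P i * u s i)
      = (\<Sum>i\<le>n. \<Sum>j\<le>degree q. coeff (monom (coeff q j) j * g) i * u s i)"
    by (simp add: coeff_sum sum_distrib_right)
  also have "\<dots> = (\<Sum>j\<le>degree q. \<Sum>i\<le>n. coeff (monom (coeff q j) j * g) i * u s i)"
    by (rule sum.swap)
  also have "int N dvd \<dots>"
  proof (rule dvd_sum)
    fix j assume j: "j \<in> {..degree q}"
    have "(\<Sum>i\<le>n. coeff (monom (coeff q j) j * g) i * u s i)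
        = (\<Sum>i\<in>{j..j+d}. coeff (monom (coeff q j) j * g) i * u s i)"
      using j dq deg_g by (intro sum.mono_neutral_right) (auto simp: coeff_monom_mult coeff_eq_0)
    also have "\<dots> = (\<Sum>i\<le>d. coeff q j * coeff g i * u s (j + i))"
      by (rule sum.reindex_bij_witness[of _ "\<lambda>i. j + i" "\<lambda>i. i - j"])
        (auto simp: coeff_monom_mult)
    also have "\<dots> = coeff q j * (\<Sum>i\<le>d. coeff g i * u s (j + i))"
      by (simp add: sum_distrib_left mult.assoc)
    finally show "int N dvd (\<Sum>i\<le>n. coeff (monom (coeff q j) j * g) i * u s i)"
      using u_recurrence by simp
  qed
  finally show ?thesis .
qed

text \<open>The summand is a character of the finite group \<open>W\<close>, so translation invariance makes its sum
  vanish unless it is trivial; only the nonnegativity of the sum matters below.\<close>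

lemma character_sum:
  fixes c :: "nat \<Rightarrow> int" and n :: nat
  defines "h \<equiv> \<lambda>s. \<Sum>i\<le>n. c i * u s i"
  shows "(\<Sum>s\<in>W. chr N (h s)) = 0 \<or> (\<Sum>s\<in>W. chr N (h s)) = of_nat (card W)"
proof (cases "\<forall>t\<in>W. chr N (h t) = 1")
  case True
  then show ?thesis by simp
next
  case False
  then obtain t where t: "t \<in> W" "chr N (h t) \<noteq> 1" by blast
  have mult: "chr N (h (add s t)) = chr N (h s) * chr N (h t)" for s
  proof -
    have "h (add s t) mod int N = (h s + h t) mod int N"
      unfolding h_def u_add sum.distrib[symmetric] distrib_left[symmetric]
      by (rule sum_mult_mod_eq)
    then show ?thesis
      by (metis chr_add chr_mod N_pos)
  qed
  have inj: "inj_on (\<lambda>s. add s t) W"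
  proof (rule inj_onI)
    fix s s' assume s: "s \<in> W" "s' \<in> W" "add s t = add s' t"
    have "s j = s' j" if "j < d" for j
    proof -
      have "(s j + t j) mod int N = (s' j + t j) mod int N"
        using fun_cong[OF s(3), of j] that by (simp add: add_def)
      then have "int N dvd s j - s' j" unfolding mod_eq_dvd_iff by simp
      moreover have "s j \<in> {0..<int N}" "s' j \<in> {0..<int N}"
        using W_mem s(1,2) that by blast+
      ultimately show ?thesis
        by (intro residue_eqI[of "int N"])
    qed
    then show "s = s'" by (rule W_eqI[OF s(1,2)])
  qed
  then have "bij_betw (\<lambda>s. add s t) W W"
    using add_W by (rule inj_on_W_imp_bij)
  then have "(\<Sum>s\<in>W. chr N (h s)) = (\<Sum>s\<in>W. chr N (h (add s t)))"
    by (rule sum.reindex_bij_betw[symmetric])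
  also have "\<dots> = (\<Sum>s\<in>W. chr N (h s)) * chr N (h t)"
    by (simp add: mult sum_distrib_right)
  finally show ?thesis using t by simp
qed

text \<open>The first \<open>m * d\<close> indices split into \<open>m\<close> windows of length
  \<open>d\<close>. AM-GM over the windows leaves a mean of \<open>m\<close>-th powers, each of
  which has the same sum over \<open>W\<close>; that sum factors over the \<open>d\<close>
  independent coordinates of the initial window.\<close>

lemma sum_dcos_blocks:
  assumes "m = 2 * h" "m < N" "h > 0"
  shows "(\<Sum>s\<in>W. \<Prod>i<m * d. dcos N (u s i)) \<le> (real N * real (m choose h)) ^ d"
proof -
  define F where "F = (\<lambda>s. \<Prod>j<d. dcos N (s j))"
  have F0: "F s \<ge> 0" for s by (simp add: F_def prod_nonneg)
  have block: "(\<Prod>i<m * d. dcos N (u s i)) = (\<Prod>b<m. F ((step ^^ (b * d)) s))" for s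
  proof -
    have "(\<Prod>i<m * d. dcos N (u s i)) = (\<Prod>b<m. \<Prod>i\<in>{b * d..<b * d + d}. dcos N (u s i))"
      by (rule prod.nat_group[symmetric])
    also have "\<dots> = (\<Prod>b<m. \<Prod>j<d. dcos N (u s (b * d + j)))"
    proof (rule prod.cong[OF refl])
      fix b
      show "(\<Prod>i\<in>{b * d..<b * d + d}. dcos N (u s i)) = (\<Prod>j<d. dcos N (u s (b * d + j)))"
        by (rule prod.reindex_bij_witness[of _ "\<lambda>j. b * d + j" "\<lambda>i. i - b * d"]) auto
    qed
    finally show ?thesis by (simp add: F_def u_window)
  qed
  have "(\<Sum>s\<in>W. \<Prod>i<m * d. dcos N (u s i)) \<le> (\<Sum>s\<in>W. (\<Sum>b<m. F ((step ^^ (b * d)) s) ^ m) / m)"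
    unfolding block using assms prod_le_mean_power[of "{..<m}" "\<lambda>b. F ((step ^^ (b * d)) _)"] F0
    by (intro sum_mono) (simp add: lessThan_empty_iff)
  also have "\<dots> = (\<Sum>b<m. \<Sum>s\<in>W. F ((step ^^ (b * d)) s) ^ m) / m"
    by (subst sum.swap) (simp add: sum_divide_distrib)
  \<comment> \<open>Each iterate of \<open>step\<close> permutes \<open>W\<close>, so every window
    may be replaced by the initial one.\<close>
  also have "\<dots> = (\<Sum>b<m. \<Sum>s\<in>W. F s ^ m) / m"
    using sum.reindex_bij_betw[OF bij_betw_funpow[OF bij_betw_step], where g = "\<lambda>s. F s ^ m"] by simp
  also have "\<dots> = (\<Sum>s\<in>W. F s ^ m)" using assms by simp
  also have "\<dots> = (\<Sum>s\<in>W. \<Prod>j<d. dcos N (s j) ^ m)"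
    by (simp add: F_def prod_power_distrib)
  also have "\<dots> = (\<Prod>j<d. \<Sum>x\<in>{0..<int N}. dcos N x ^ m)"
    unfolding W_def by (rule prod_sum_PiE[symmetric]) auto
  also have "\<dots> = (real N * real (m choose h)) ^ d"
    using sum_dcos_power[OF assms(2,1)] by simp
  finally show ?thesis .
qed

text \<open>For a multiple of \<open>g\<close> every character value in \<open>S\<close> is 1, so
  \<open>S\<close> equals \<open>card W\<close>. Summing \<open>S\<close> over all sign patterns and
  exchanging the sums lets the independent signs factor into cosines, to which the block estimate
  applies.\<close>

lemma card_sign_multiples_le_recurrence:
  assumes "m = 2 * h" "m < N" "h > 0" "m * d \<le> n"
  shows "real (card {\<epsilon> \<in> signs n. g dvd sign_poly n \<epsilon>}) \<le> 2 ^ (n - m * d) * real (m choose h) ^ d"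
proof -
  define Z where "Z = {\<epsilon> \<in> signs n. g dvd sign_poly n \<epsilon>}"
  define S where "S = (\<lambda>\<epsilon>. \<Sum>s\<in>W. chr N (\<Sum>i\<le>n. coeff (sign_poly n \<epsilon>) i * u s i))"
  have "real (card Z) * real (card W) = (\<Sum>\<epsilon>\<in>Z. Re (S \<epsilon>))"
  proof -
    have "Re (S \<epsilon>) = real (card W)" if "\<epsilon> \<in> Z" for \<epsilon>
    proof -
      have nz: "sign_poly n \<epsilon> \<noteq> 0"
        by (metis coeff_0 coeff_sign_poly less_irrefl zero_neq_one)
      have "chr N (\<Sum>i\<le>n. coeff (sign_poly n \<epsilon>) i * u s i) = 1" for s
        using dvd_imp_functional_dvd[of "sign_poly n \<epsilon>" n s] that nz chr_eq_1_iff[OF N_pos]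
        by (simp add: Z_def degree_sign_poly)
      then show ?thesis by (simp add: S_def)
    qed
    then show ?thesis by simp
  qed
  \<comment> \<open>By \<open>character_sum\<close> each \<open>S\<close> is 0 or
    \<open>card W\<close>, so the added terms are nonnegative.\<close>
  also have "\<dots> \<le> (\<Sum>\<epsilon>\<in>signs n. Re (S \<epsilon>))"
  proof (rule sum_mono2)
    fix \<epsilon>
    show "0 \<le> Re (S \<epsilon>)"
      unfolding S_def using character_sum[of "coeff (sign_poly n \<epsilon>)" n] by (auto simp del: Re_sum)
  qed (auto simp: Z_def)
  also have "\<dots> = Re (\<Sum>s\<in>W. \<Sum>\<epsilon>\<in>signs n. chr N (\<Sum>i\<le>n. coeff (sign_poly n \<epsilon>) i * u s i))"
    unfolding S_def Re_sum[symmetric] by (subst sum.swap) simp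
  also have "\<dots> \<le> cmod (\<Sum>s\<in>W. \<Sum>\<epsilon>\<in>signs n. chr N (\<Sum>i\<le>n. coeff (sign_poly n \<epsilon>) i * u s i))"
    by (rule complex_Re_le_cmod)
  also have "\<dots> \<le> (\<Sum>s\<in>W. cmod (\<Sum>\<epsilon>\<in>signs n. chr N (\<Sum>i\<le>n. coeff (sign_poly n \<epsilon>) i * u s i)))"
    by (rule norm_sum)
  also have "\<dots> = (\<Sum>s\<in>W. \<Prod>i<n. dcos N (u s i))"
  proof (intro sum.cong refl)
    fix s
    have "(\<Sum>\<epsilon>\<in>signs n. chr N (\<Sum>i\<le>n. coeff (sign_poly n \<epsilon>) i * u s i))
        = (\<Sum>\<epsilon>\<in>signs n. chr N (u s n) * (\<Prod>i<n. chr N (\<epsilon> i * u s i)))"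
    proof (intro sum.cong refl)
      fix \<epsilon>
      have "(\<Sum>i\<le>n. coeff (sign_poly n \<epsilon>) i * u s i) = u s n + (\<Sum>i<n. \<epsilon> i * u s i)"
        by (simp add: coeff_sign_poly flip: lessThan_Suc_atMost)
      then show "chr N (\<Sum>i\<le>n. coeff (sign_poly n \<epsilon>) i * u s i)
          = chr N (u s n) * (\<Prod>i<n. chr N (\<epsilon> i * u s i))"
        by (simp add: chr_add chr_sum)
    qed
    also have "\<dots> = chr N (u s n) * (\<Sum>\<epsilon>\<in>signs n. \<Prod>i<n. chr N (\<epsilon> i * u s i))"
      by (simp add: sum_distrib_left)
    also have "(\<Sum>\<epsilon>\<in>signs n. \<Prod>i<n. chr N (\<epsilon> i * u s i)) = (\<Prod>i<n. \<Sum>e\<in>{-1, 1}. chr N (e * u s i))"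
      unfolding signs_def by (rule prod_sum_PiE[symmetric]) auto
    also have "\<dots> = (\<Prod>i<n. of_real (2 * cos (2 * pi * of_int (u s i) / of_nat N)))"
      by (simp only: chr_plus_chr_minus[symmetric]) simp
    finally show "cmod (\<Sum>\<epsilon>\<in>signs n. chr N (\<Sum>i\<le>n. coeff (sign_poly n \<epsilon>) i * u s i))
        = (\<Prod>i<n. dcos N (u s i))"
      by (simp only: norm_mult norm_chr prod_norm[symmetric] norm_of_real dcos_def mult_1_left)
  qed
  \<comment> \<open>The indices from \<open>m * d\<close> on do not belong to the chosen windows and
    get the trivial bound 2.\<close>
  also have "\<dots> \<le> (\<Sum>s\<in>W. 2 ^ (n - m * d) * (\<Prod>i<m * d. dcos N (u s i)))"
  proof (rule sum_mono)
    fix s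
    have "(\<Prod>i<n. dcos N (u s i)) = (\<Prod>i\<in>{m * d..<n}. dcos N (u s i)) * (\<Prod>i<m * d. dcos N (u s i))"
      using assms(4) prod.subset_diff[of "{..<m * d}" "{..<n}" "\<lambda>i. dcos N (u s i)"]
      by (simp add: ivl_disj_un lessThan_minus_lessThan)
    also have "\<dots> \<le> (\<Prod>i\<in>{m * d..<n}. 2) * (\<Prod>i<m * d. dcos N (u s i))"
      by (intro mult_right_mono prod_mono prod_nonneg) (auto simp: dcos_le_2)
    finally show "(\<Prod>i<n. dcos N (u s i)) \<le> 2 ^ (n - m * d) * (\<Prod>i<m * d. dcos N (u s i))"
      by simp
  qed
  also have "\<dots> \<le> 2 ^ (n - m * d) * (real N * real (m choose h)) ^ d"
    using sum_dcos_blocks[OF assms(1-3)] by (simp flip: sum_distrib_left)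
  finally have "real (card Z) * real N ^ d \<le> (2 ^ (n - m * d) * real (m choose h) ^ d) * real N ^ d"
    by (simp add: card_W power_mult_distrib mult_ac)
  then show ?thesis
    using N_pos by (simp add: Z_def)
qed

end

lemma card_sign_multiples_le:
  fixes g :: "int poly"
  assumes "degree g = d" "lead_coeff g = 1" "\<bar>coeff g 0\<bar> = 1" "d > 0" "h > 0" "2 * h * d \<le> n"
  shows "real (card {\<epsilon> \<in> signs n. g dvd sign_poly n \<epsilon>})
    \<le> 2 ^ (n - 2 * h * d) * real (2 * h choose h) ^ d"
proof -
  \<comment> \<open>The least modulus exceeding the exponent \<open>2 * h\<close>; the resulting
    bound does not depend on the modulus.\<close>
  interpret linear_recurrence g d "2 * h + 1"
    using assms by unfold_locales auto
  show ?thesis using card_sign_multiples_le_recurrence[of "2 * h" h n] assms by simp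
qed

section \<open>Roots away from the unit circle\<close>

lemma sum_powers_le:
  fixes x :: real
  assumes "x \<ge> 2"
  shows "(\<Sum>j<t. x ^ j) \<le> x ^ t - 1"
proof (induction t)
  case (Suc t)
  have "2 * x ^ t \<le> x * x ^ t" using assms by (intro mult_right_mono) auto
  then show ?case using Suc by simp
qed simp

text \<open>Uniqueness of digits in base \<open>w\<close>: a nonzero top digit contributes
  \<open>2 * cmod w ^ t\<close>, while the lower digits together reach at most
  \<open>2 * (cmod w ^ t - 1)\<close>. The digits -2, 0, 2 are the differences of two signs.\<close>

lemma digits_eq_0:
  fixes w :: complex and c :: "nat \<Rightarrow> int"
  assumes "cmod w \<ge> 2" "\<And>j. j < t \<Longrightarrow> c j \<in> {-2, 0, 2}" "(\<Sum>j<t. of_int (c j) * w ^ j) = 0" "j < t"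
  shows "c j = 0"
  using assms(2-4)
proof (induction t arbitrary: j)
  case (Suc t)
  have "c t = 0"
  proof (rule ccontr)
    assume "c t \<noteq> 0"
    then have ct: "cmod (of_int (c t)) = 2" using Suc.prems(1)[of t] by auto
    have "of_int (c t) * w ^ t = - (\<Sum>j<t. of_int (c j) * w ^ j)"
      using Suc.prems(2) by (simp add: eq_neg_iff_add_eq_0 add.commute)
    then have "2 * cmod w ^ t = cmod (\<Sum>j<t. of_int (c j) * w ^ j)"
      by (metis ct norm_minus_cancel norm_mult norm_power)
    also have "\<dots> \<le> (\<Sum>j<t. cmod (of_int (c j) * w ^ j))" by (rule norm_sum)
    also have "\<dots> \<le> (\<Sum>j<t. 2 * cmod w ^ j)"
    proof (rule sum_mono)
      fix j assume "j \<in> {..<t}"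
      then have "c j \<in> {-2, 0, 2}" using Suc.prems(1) by simp
      then show "cmod (of_int (c j) * w ^ j) \<le> 2 * cmod w ^ j"
        unfolding norm_mult norm_power by (intro mult_right_mono) auto
    qed
    also have "\<dots> \<le> 2 * (cmod w ^ t - 1)"
      using sum_powers_le[OF assms(1), of t] by (simp flip: sum_distrib_left)
    finally show False by simp
  qed
  then show ?case
    using Suc.IH[of j] Suc.prems by (cases "j = t") auto
qed simp

lemma poly_sign_poly:
  "poly (cpoly (sign_poly n \<epsilon>)) z = z ^ n + (\<Sum>i<n. of_int (\<epsilon> i) * z ^ i)"
  by (simp add: poly_altdef degree_sign_poly coeff_sign_poly flip: lessThan_Suc_atMost)

text \<open>At a point of modulus at least 2 the lower terms add up to at most
  \<open>cmod z ^ n - 1\<close>, too little to cancel \<open>z ^ n\<close>.\<close>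

lemma sign_poly_root_bound:
  assumes "\<epsilon> \<in> signs n" "poly (cpoly (sign_poly n \<epsilon>)) z = 0"
  shows "cmod z < 2"
proof (rule ccontr)
  assume "\<not> cmod z < 2"
  then have z: "cmod z \<ge> 2" by simp
  have "z ^ n = - (\<Sum>i<n. of_int (\<epsilon> i) * z ^ i)"
    using assms(2) by (simp add: poly_sign_poly eq_neg_iff_add_eq_0)
  then have "cmod z ^ n = cmod (\<Sum>i<n. of_int (\<epsilon> i) * z ^ i)"
    by (metis norm_minus_cancel norm_power)
  also have "\<dots> \<le> (\<Sum>i<n. cmod (of_int (\<epsilon> i) * z ^ i))" by (rule norm_sum)
  also have "\<dots> = (\<Sum>i<n. cmod z ^ i)"
  proof (intro sum.cong refl)
    fix i assume "i \<in> {..<n}"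
    then have "\<epsilon> i \<in> {-1, 1}" using signs_mem[OF assms(1)] by simp
    then show "cmod (of_int (\<epsilon> i) * z ^ i) = cmod z ^ i" by (auto simp: norm_mult norm_power)
  qed
  also have "\<dots> \<le> cmod z ^ n - 1" by (rule sum_powers_le[OF z])
  finally show False by simp
qed

text \<open>If two patterns with root \<open>\<alpha>\<close> agree off \<open>J\<close>,
  subtracting the equations leaves a vanishing digit expansion in base \<open>\<alpha> ^ d\<close>,
  so they agree on \<open>J\<close> as well. Hence the \<open>n - n div d\<close> signs off
  \<open>J\<close> determine the pattern.\<close>

lemma card_sign_root_le:
  assumes "d > 0" "cmod \<alpha> ^ d \<ge> 2"
  shows "real (card {\<epsilon> \<in> signs n. poly (cpoly (sign_poly n \<epsilon>)) \<alpha> = 0}) \<le> 2 ^ (n - n div d)"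
proof -
  define J where "J = (\<lambda>j. j * d) ` {..<n div d}"
  define Z where "Z = {\<epsilon> \<in> signs n. poly (cpoly (sign_poly n \<epsilon>)) \<alpha> = 0}"
  define T where "T = PiE ({..<n} - J) (\<lambda>_. {-1, 1 :: int})"
  have injJ: "inj_on (\<lambda>j. j * d) {..<n div d}"
    using assms(1) by (auto simp: inj_on_def)
  have J: "J \<subseteq> {..<n}"
  proof
    fix i assume "i \<in> J"
    then obtain j where "j < n div d" "i = j * d" by (auto simp: J_def)
    moreover have "n div d * d \<le> n" by simp
    ultimately show "i \<in> {..<n}" using assms(1)
      by (metis lessThan_iff less_le_trans mult_less_mono1)
  qed
  have "inj_on (\<lambda>\<epsilon>. restrict \<epsilon> ({..<n} - J)) Z"
  proof (rule inj_onI)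
    fix \<epsilon> \<delta> assume Z: "\<epsilon> \<in> Z" "\<delta> \<in> Z" and eq: "restrict \<epsilon> ({..<n} - J) = restrict \<delta> ({..<n} - J)"
    have off: "\<epsilon> i = \<delta> i" if "i \<in> {..<n} - J" for i
      using eq that by (metis restrict_apply')
    have mem: "\<epsilon> i \<in> {-1, 1}" "\<delta> i \<in> {-1, 1}" if "i < n" for i
      using Z signs_mem[OF _ that] unfolding Z_def by blast+
    have "(\<Sum>i<n. of_int (\<epsilon> i) * \<alpha> ^ i) - (\<Sum>i<n. of_int (\<delta> i) * \<alpha> ^ i) = 0"
      using Z by (simp add: Z_def poly_sign_poly add_eq_0_iff)
    then have "0 = (\<Sum>i<n. of_int (\<epsilon> i - \<delta> i) * \<alpha> ^ i)"
      by (simp add: sum_subtractf left_diff_distrib)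
    also have "\<dots> = (\<Sum>i\<in>J. of_int (\<epsilon> i - \<delta> i) * \<alpha> ^ i)"
      using J off by (intro sum.mono_neutral_right) auto
    also have "\<dots> = (\<Sum>j<n div d. of_int (\<epsilon> (j * d) - \<delta> (j * d)) * (\<alpha> ^ d) ^ j)"
      unfolding J_def by (subst sum.reindex[OF injJ]) (simp add: power_mult[symmetric] mult.commute)
    finally have zero: "(\<Sum>j<n div d. of_int (\<epsilon> (j * d) - \<delta> (j * d)) * (\<alpha> ^ d) ^ j) = 0" by simp
    have "\<epsilon> (j * d) - \<delta> (j * d) = 0" if "j < n div d" for j
    proof (rule digits_eq_0[of "\<alpha> ^ d" "n div d" "\<lambda>j. \<epsilon> (j * d) - \<delta> (j * d)"])
      fix k assume "k < n div d"
      then have "k * d < n" using J by (auto simp: J_def)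
      from mem[OF this] show "\<epsilon> (k * d) - \<delta> (k * d) \<in> {-2, 0, 2}" by auto
    qed (use assms zero that in \<open>auto simp: norm_power\<close>)
    then have on: "\<epsilon> i = \<delta> i" if "i \<in> J" for i
      using that by (auto simp: J_def)
    show "\<epsilon> = \<delta>"
    proof (rule signs_eqI)
      show "\<epsilon> i = \<delta> i" if "i < n" for i
        using on off that by blast
    qed (use Z in \<open>simp_all add: Z_def\<close>)
  qed
  moreover have "(\<lambda>\<epsilon>. restrict \<epsilon> ({..<n} - J)) ` Z \<subseteq> T"
  proof (rule image_subsetI)
    fix \<epsilon> assume "\<epsilon> \<in> Z"
    then have "\<epsilon> i \<in> {-1, 1}" if "i \<in> {..<n} - J" for i
      using signs_mem[of \<epsilon> n i] that by (simp add: Z_def)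
    then show "restrict \<epsilon> ({..<n} - J) \<in> T"
      unfolding T_def restrict_PiE_iff by blast
  qed
  moreover have "finite T" unfolding T_def by (intro finite_PiE) auto
  ultimately have "card Z \<le> card T" by (rule card_inj_on_le)
  also have "card T = 2 ^ (n - n div d)"
    unfolding T_def using J card_image[OF injJ]
    by (subst card_PiE) (simp_all add: card_Diff_subset finite_subset[OF J] J_def[symmetric] numeral_2_eq_2)
  finally have "real (card Z) \<le> real (2 ^ (n - n div d))" by (rule of_nat_mono)
  then show ?thesis by (simp add: Z_def)
qed

section \<open>Monic integer factors\<close>

lemma ex_common_denominator:
  assumes "finite (A :: rat set)"
  shows "\<exists>c::int. c > 0 \<and> (\<forall>a\<in>A. of_int c * a \<in> \<int>)"
  using assms
proof induction
  case empty
  show ?case by (intro exI[of _ 1]) simp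
next
  case (insert a A)
  then obtain c where c: "c > 0" "\<forall>a\<in>A. of_int c * a \<in> \<int>" by blast
  obtain p q where a: "a = Rat.Fract p q" "q > 0" by (cases a) auto
  have "of_int q * a = of_int p" using a by (simp add: Fract_of_int_quotient)
  then have "of_int (q * c) * a \<in> \<int>"
    by (metis Ints_mult Ints_of_int mult.assoc mult.commute of_int_mult)
  moreover have "of_int (q * c) * b \<in> \<int>" if "b \<in> A" for b
    using c that by (metis Ints_mult Ints_of_int mult.assoc of_int_mult)
  ultimately show ?case
    using c a by (intro exI[of _ "q * c"]) auto
qed

lemma ex_int_poly_multiple:
  fixes m :: "rat poly"
  shows "\<exists>(c::int) q. c > 0 \<and> map_poly of_int q = smult (of_int c) m"
proof -
  obtain c :: int where c: "c > 0" "\<forall>a\<in>coeff m ` {..degree m}. of_int c * a \<in> \<int>"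
    using ex_common_denominator[of "coeff m ` {..degree m}"] by blast
  have "of_int c * coeff m i \<in> \<int>" for i
    using c by (cases "i \<le> degree m") (auto simp: coeff_eq_0)
  then have "\<exists>f. \<forall>i. of_int c * coeff m i = of_int (f i)"
    by (intro choice) (metis Ints_cases)
  then obtain f where f: "\<And>i. of_int c * coeff m i = of_int (f i)" by blast
  define q where "q = (\<Sum>i\<le>degree m. monom (f i) i)"
  have "coeff q i = f i" for i
  proof (cases "i \<le> degree m")
    case False
    then have "of_int (f i) = (0 :: rat)" using f[of i] by (simp add: coeff_eq_0)
    with False show ?thesis by (simp add: q_def coeff_sum)
  qed (simp add: q_def coeff_sum)
  then have "map_poly of_int q = smult (of_int c) m"
    by (intro poly_eqI) (simp add: coeff_map_poly f)
  with c(1) show ?thesis by blast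
qed

lemma rat_annihilates_of_int_poly: "rat_annihilates (map_poly of_int q) z \<longleftrightarrow> poly (cpoly q) z = 0"
proof -
  have "map_poly of_rat (map_poly of_int q :: rat poly) = cpoly q"
    by (rule poly_eqI) (simp add: coeff_map_poly)
  then show ?thesis by (simp add: rat_annihilates_def)
qed

text \<open>Gauss's lemma: \<open>k\<close> becomes a unit over the fraction field, and divisibility
  by a primitive polynomial descends to the integers.\<close>

lemma primitive_dvd_smult_iff:
  fixes g P :: "int poly"
  assumes "content g = 1" "k \<noteq> 0" "g dvd smult k P"
  shows "g dvd P"
proof -
  have "fract_poly g dvd smult (to_fract k) (fract_poly P)"
    using fract_poly_dvd[OF assms(3)] by simp
  then have "fract_poly g dvd fract_poly P"
    using assms(2) by (simp add: dvd_smult_iff)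
  then show ?thesis using assms(1) by (rule fract_poly_dvdD)
qed

text \<open>Clearing denominators in the minimal polynomial and taking the primitive part gives
  \<open>g\<close>. The remainder of \<open>P\<close> modulo \<open>g\<close> vanishes at
  \<open>z\<close> with smaller degree, hence is zero, and Gauss's lemma gives
  \<open>g dvd P\<close>. As \<open>P\<close> is monic, the leading coefficient of \<open>g\<close>
  is 1 or -1, and negating \<open>g\<close> settles the second case.\<close>

lemma ex_monic_int_factor:
  fixes P :: "int poly"
  assumes "lead_coeff P = 1" "poly (cpoly P) z = 0"
  obtains g where "lead_coeff g = 1" "g dvd P" "degree g = algebraic_degree z" "poly (cpoly g) z = 0"
proof -
  let ?Q = "\<lambda>p. lead_coeff p = 1 \<and> rat_annihilates p z \<and>
     (\<forall>q. q \<noteq> 0 \<longrightarrow> rat_annihilates q z \<longrightarrow> degree p \<le> degree q)"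
  have P0: "P \<noteq> 0" using assms(1) by auto
  have "algebraic z"
    unfolding algebraic_iff_rat_annihilates
    using P0 assms(2) by (intro exI[of _ "map_poly of_int P"]) (simp add: rat_annihilates_of_int_poly map_poly_eq_0_iff)
  then have "?Q (minimal_poly z)"
    unfolding minimal_poly_def by (rule theI'[OF minimal_poly_exists_unique])
  then obtain m where m: "m = minimal_poly z" "?Q m" by blast
  obtain c q where q: "c > 0" "map_poly of_int q = smult (of_int c) m"
    using ex_int_poly_multiple by blast
  define g where "g = primitive_part q"
  have q0: "q \<noteq> 0" using q m by auto
  have deg_int: "degree (map_poly of_int r :: rat poly) = degree r" for r
    by (rule degree_map_poly) simp
  have dq: "degree q = algebraic_degree z"
    using q deg_int[of q] by (simp add: algebraic_degree_def m(1))
  have "poly (cpoly q) z = 0"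
    using m q rat_annihilates_smult[of m z "of_int c"] by (simp flip: rat_annihilates_of_int_poly)
  moreover have "cpoly q = smult (of_int (content q)) (cpoly g)"
  proof (rule poly_eqI)
    fix i
    have "coeff q i = content q * coeff g i"
      by (metis g_def coeff_smult content_times_primitive_part)
    then show "coeff (cpoly q) i = coeff (smult (of_int (content q)) (cpoly g)) i" by simp
  qed
  ultimately have gz: "poly (cpoly g) z = 0"
    using q0 by simp
  have dg: "degree g = algebraic_degree z" "g \<noteq> 0" "content g = 1"
    using q0 dq by (auto simp: g_def)
  \<comment> \<open>At this point \<open>g\<close> is not known to be monic, so division is possible
    only after scaling \<open>P\<close> by some nonzero \<open>a\<close>.\<close>
  define r where "r = pseudo_mod P g"
  obtain a h where ah: "a \<noteq> 0" "smult a P = g * h + r"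
    using pseudo_mod(1)[OF dg(2), of P] unfolding r_def by blast
  have "r = 0"
  proof (rule ccontr)
    assume r: "r \<noteq> 0"
    have "r = [:a:] * P - g * h" using ah by simp
    then have "cpoly r = cpoly ([:a:] * P) - cpoly (g * h)"
      by (intro poly_eqI) simp
    then have "poly (cpoly r) z = 0"
      using assms(2) gz unfolding cpoly_mult by simp
    moreover have "(map_poly of_int r :: rat poly) \<noteq> 0"
      using r by (simp add: map_poly_eq_0_iff)
    ultimately have "degree m \<le> degree r"
      using m deg_int[of r] by (metis rat_annihilates_of_int_poly)
    moreover have "degree r < degree g"
      using pseudo_mod(2)[OF dg(2), of P] r by (auto simp: r_def)
    ultimately show False using dg m(1) by (simp add: algebraic_degree_def)
  qed
  then have "g dvd smult a P" using ah by simp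
  then have gP: "g dvd P" using primitive_dvd_smult_iff dg(3) ah(1) by blast
  then obtain h' where "P = g * h'" by (elim dvdE)
  then have "lead_coeff g * lead_coeff h' = 1"
    using assms(1) by (simp add: lead_coeff_mult)
  then have lc: "lead_coeff g = 1 \<or> lead_coeff g = -1"
    using zmult_eq_1_iff by blast
  show ?thesis
  proof (cases "lead_coeff g = 1")
    case True
    then show ?thesis using that gP dg gz by blast
  next
    case False
    have "cpoly (- g) = - cpoly g" by (rule poly_eqI) simp
    then show ?thesis using that[of "- g"] gP dg gz lc False by simp
  qed
qed

section \<open>Summation over the degree\<close>

text \<open>Induction: consecutive central binomials have ratio
  \<open>2 * (2 * h + 1) / (h + 1)\<close>, and the step comes down to
  \<open>(2 * h + 1) * (2 * h + 3) \<le> 4 * (h + 1)\<^sup>2\<close>.\<close>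

lemma central_binomial_upper: "real (2 * h choose h) * sqrt (real (2 * h + 1)) \<le> 4 ^ h"
proof (induction h)
  case (Suc h)
  have "real (2 * Suc h choose Suc h) = real (2 * h choose h) * (2 * (2 * real h + 1) / (real h + 1))"
  proof -
    define c where "c = real h + 1"
    have c: "c \<noteq> 0" "real (Suc h) = c" by (simp_all add: c_def)
    have "2 * Suc h = Suc (Suc (2 * h))" by simp
    then have "fact (2 * Suc h) = 2 * c * (2 * real h + 1) * (fact (2 * h) :: real)"
      by (simp only: fact_Suc of_nat_mult of_nat_Suc of_nat_numeral) (simp add: c_def algebra_simps)
    moreover have "real (2 * Suc h choose Suc h) = fact (2 * Suc h) / (fact (Suc h) * fact (Suc h))"
      by (subst binomial_fact) simp_all
    ultimately have "real (2 * Suc h choose Suc h)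
        = 2 * c * (2 * real h + 1) * fact (2 * h) / ((c * fact h) * (c * fact h))"
      by (simp only: fact_Suc[of h] c(2))
    also have "\<dots> = fact (2 * h) / (fact h * fact h) * (2 * (2 * real h + 1) / c)"
      using c(1) by (simp add: divide_simps)
    also have "fact (2 * h) / (fact h * fact h) = real (2 * h choose h)"
      by (simp add: binomial_fact)
    finally show ?thesis by (simp add: c_def add.commute del: binomial_Suc_Suc)
  qed
  moreover have "2 * (2 * real h + 1) / (real h + 1) * sqrt (real (2 * Suc h + 1)) \<le> 4 * sqrt (2 * real h + 1)"
  proof (rule power2_le_imp_le)
    \<comment> \<open>With \<open>a = 2 * h + 1\<close> these expose the common factor
      \<open>4 * a\<close> of both sides of the squared inequality.\<close>
    have eq1: "(2 * a)\<^sup>2 * b = 4 * a * (a * b)" and eq2: "16 * a * b\<^sup>2 = 4 * a * (4 * b\<^sup>2)"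
      for a b :: real
      by (simp_all add: power2_eq_square)
    have "(2 * real h + 1) * (2 * real h + 3) \<le> 4 * (real h + 1)\<^sup>2"
      by (simp add: power2_eq_square algebra_simps)
    then have "4 * (2 * real h + 1) * ((2 * real h + 1) * (2 * real h + 3))
        \<le> 4 * (2 * real h + 1) * (4 * (real h + 1)\<^sup>2)"
      by (intro mult_left_mono) auto
    then have "(2 * (2 * real h + 1))\<^sup>2 * (2 * real h + 3) \<le> 16 * (2 * real h + 1) * (real h + 1)\<^sup>2"
      unfolding eq1[of "2 * real h + 1"] eq2[of "2 * real h + 1"] .
    then show "(2 * (2 * real h + 1) / (real h + 1) * sqrt (real (2 * Suc h + 1)))\<^sup>2 \<le> (4 * sqrt (2 * real h + 1))\<^sup>2"
      by (simp add: power_mult_distrib power_divide divide_simps add_ac)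
  qed simp
  ultimately have "real (2 * Suc h choose Suc h) * sqrt (real (2 * Suc h + 1))
      \<le> real (2 * h choose h) * (4 * sqrt (2 * real h + 1))"
    by (simp only: mult.assoc) (intro mult_left_mono, simp_all)
  also have "\<dots> \<le> 4 ^ Suc h"
    using Suc by (simp add: add.commute mult.left_commute)
  finally show ?case .
qed simp

section \<open>Union bound over the factors of a fixed degree\<close>

definition multiples :: "nat \<Rightarrow> nat \<Rightarrow> (nat \<Rightarrow> int) set" where
  "multiples n d = {\<epsilon> \<in> signs n. \<exists>g\<in>monic_int d. g dvd sign_poly n \<epsilon>}"

lemma card_UN_real_le:
  assumes "finite I" "\<And>i. i \<in> I \<Longrightarrow> real (card (F i)) \<le> b" "real (card I) \<le> c" "b \<ge> 0"
  shows "real (card (\<Union>i\<in>I. F i)) \<le> c * b"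
proof -
  have "real (card (\<Union>i\<in>I. F i)) \<le> real (\<Sum>i\<in>I. card (F i))"
    using card_UN_le[OF assms(1), of F] by (simp only: of_nat_le_iff)
  also have "\<dots> \<le> real (card I) * b"
    using sum_bounded_above[of I "\<lambda>i. real (card (F i))" b] assms(2) by simp
  also have "\<dots> \<le> c * b" using assms by (intro mult_right_mono)
  finally show ?thesis .
qed

lemma card_sign_multiples_le_sqrt:
  assumes "degree g = d" "lead_coeff g = 1" "\<bar>coeff g 0\<bar> = 1" "d > 0" "2 * d \<le> n"
  shows "real (card {\<epsilon> \<in> signs n. g dvd sign_poly n \<epsilon>}) \<le> 2 ^ n * sqrt (2 * real d / real n) ^ d"
proof -
  \<comment> \<open>The largest \<open>h\<close> for which \<open>2 * h\<close> windows of length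
    \<open>d\<close> fit below \<open>n\<close>; then \<open>n / (2 * d) \<le> 2 * h + 1\<close>,
    which turns the central binomial bound into one in terms of \<open>n\<close>.\<close>
  define h where "h = n div (2 * d)"
  have n: "n > 0" using assms(4,5) by simp
  have h: "h > 0" "2 * h * d \<le> n" "n < 2 * d * (h + 1)"
    using assms(4,5) div_greater_zero_iff[of n "2 * d"] times_div_less_eq_dividend[of "2 * d" n]
      dividend_less_times_div[of "2 * d" n]
    by (simp_all add: h_def mult_ac)
  have "real n \<le> 2 * real d * (real h + 1)"
    using of_nat_mono[OF less_imp_le[OF h(3)], where ?'a = real] by (simp add: algebra_simps)
  also have "\<dots> \<le> 2 * real d * (2 * real h + 1)"
    by (intro mult_left_mono) auto
  finally have "1 \<le> 2 * real d / real n * (2 * h + 1)"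
    using n by (simp add: field_simps)
  then have "1 \<le> sqrt (2 * real d / real n * (2 * h + 1))" by simp
  then have one: "1 \<le> sqrt (2 * real d / real n) * sqrt (real (2 * h + 1))" by (simp only: real_sqrt_mult)
  have "real (2 * h choose h) * 1 \<le> real (2 * h choose h) * (sqrt (2 * real d / real n) * sqrt (real (2 * h + 1)))"
    by (intro mult_left_mono one) simp
  also have "\<dots> = (real (2 * h choose h) * sqrt (real (2 * h + 1))) * sqrt (2 * real d / real n)"
    by (simp only: mult_ac)
  also have "\<dots> \<le> 4 ^ h * sqrt (2 * real d / real n)"
    by (intro mult_right_mono central_binomial_upper) simp
  finally have "real (2 * h choose h) \<le> 4 ^ h * sqrt (2 * real d / real n)" by simp
  then have "real (2 * h choose h) ^ d \<le> (4 ^ h * sqrt (2 * real d / real n)) ^ d"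
    by (intro power_mono) auto
  then have "2 ^ (n - 2 * h * d) * real (2 * h choose h) ^ d
      \<le> 2 ^ (n - 2 * h * d) * (4 ^ h * sqrt (2 * real d / real n)) ^ d"
    by (intro mult_left_mono) auto
  also have "\<dots> = (2 ^ (n - 2 * h * d) * 2 ^ (2 * h * d)) * sqrt (2 * real d / real n) ^ d"
    by (simp add: power_mult_distrib power_mult)
  also have "(2::real) ^ (n - 2 * h * d) * 2 ^ (2 * h * d) = 2 ^ n"
    using h(2) by (simp flip: power_add)
  finally show ?thesis
    using card_sign_multiples_le[OF assms(1-4) h(1,2)] by linarith
qed

text \<open>Candidates in \<open>T1\<close> have all roots within radius \<open>1 + 1 / d\<close>
  and fall under the recurrence bound; those in \<open>T2\<close> have a root outside that radius
  and fall under the digit bound. The two summands correspond to these cases.\<close>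

lemma card_multiples_le:
  assumes "d > 0" "2 * d \<le> n"
  shows "real (card (multiples n d))
    \<le> 2 ^ n * ((9 * real d * sqrt (2 * real d / real n)) ^ d + (3 * real d * 2 ^ d) ^ d / 2 ^ (n div d))"
proof -
  define S1 where "S1 = {g \<in> monic_int d. \<forall>z. poly (cpoly g) z = 0 \<longrightarrow> cmod z \<le> 1 + 1 / real d}"
  define S2 where "S2 = {g \<in> monic_int d. \<forall>z. poly (cpoly g) z = 0 \<longrightarrow> cmod z \<le> 2}"
  define T1 where "T1 = {g \<in> S1. \<bar>coeff g 0\<bar> = 1}"
  define T2 where "T2 = S2 - S1"
  let ?F = "\<lambda>g. {\<epsilon> \<in> signs n. g dvd sign_poly n \<epsilon>}"
  have S1: "finite S1" "real (card S1) \<le> (3 * real d * (1 + 1 / real d) ^ d) ^ d"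
    unfolding S1_def using assms(1) by (intro count_monic_int_bounded_roots; simp)+
  have S2: "finite S2" "real (card S2) \<le> (3 * real d * 2 ^ d) ^ d"
    unfolding S2_def using assms(1) by (intro count_monic_int_bounded_roots; simp)+
  \<comment> \<open>The radius \<open>1 + 1 / d\<close> keeps its \<open>d\<close>-th power bounded,
    so that \<open>T1\<close> has at most \<open>(9 * d) ^ d\<close> elements.\<close>
  have "(1 + 1 / real d) ^ d \<le> exp (1 / real d) ^ d"
    by (intro power_mono exp_ge_add_one_self) auto
  also have "\<dots> = exp 1" using assms(1) by (simp flip: exp_of_nat_mult)
  also have "\<dots> \<le> 3" by (rule exp_le)
  finally have e3: "(1 + 1 / real d) ^ d \<le> 3" .
  have "real (card T1) \<le> real (card S1)"
    unfolding T1_def using S1(1) by (intro of_nat_mono card_mono) auto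
  also have "\<dots> \<le> (3 * real d * (1 + 1 / real d) ^ d) ^ d" by (rule S1(2))
  also have "\<dots> \<le> (3 * real d * 3) ^ d"
    using e3 by (intro power_mono mult_left_mono) auto
  finally have T1: "real (card T1) \<le> (9 * real d) ^ d" by (simp add: mult.commute)
  have "real (card T2) \<le> real (card S2)"
    unfolding T2_def using S2(1) by (intro of_nat_mono card_mono) auto
  with S2(2) have T2: "real (card T2) \<le> (3 * real d * 2 ^ d) ^ d" by linarith
  have "multiples n d \<subseteq> (\<Union>g\<in>T1. ?F g) \<union> (\<Union>g\<in>T2. ?F g)"
  proof
    fix \<epsilon> assume "\<epsilon> \<in> multiples n d"
    then obtain g where \<epsilon>: "\<epsilon> \<in> signs n" and g: "g \<in> monic_int d" "g dvd sign_poly n \<epsilon>"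
      by (auto simp: multiples_def)
    from g(2) obtain q where q: "sign_poly n \<epsilon> = g * q" by (elim dvdE)
    have "cmod z \<le> 2" if "poly (cpoly g) z = 0" for z
      using sign_poly_root_bound[OF \<epsilon>, of z] that by (simp add: q cpoly_mult)
    then have S2: "g \<in> S2" using g by (simp add: S2_def)
    \<comment> \<open>The constant coefficient of a factor divides a sign, which supplies the unit
      condition of the recurrence.\<close>
    have "coeff g 0 * coeff q 0 = \<epsilon> 0"
      using coeff_sign_poly[of n \<epsilon> 0] assms by (simp add: q coeff_mult)
    then have "coeff g 0 dvd 1"
      using signs_mem[OF \<epsilon>, of 0] assms dvd_triv_left[of "coeff g 0" "coeff q 0"] by auto
    then have "\<bar>coeff g 0\<bar> = 1" by simp
    then have "g \<in> T1 \<or> g \<in> T2"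
      using S2 by (auto simp: T1_def T2_def)
    then show "\<epsilon> \<in> (\<Union>g\<in>T1. ?F g) \<union> (\<Union>g\<in>T2. ?F g)"
      using \<epsilon> g(2) by blast
  qed
  moreover have fin: "finite T1" "finite T2"
    using S1(1) S2(1) by (auto simp: T1_def T2_def)
  ultimately have "card (multiples n d) \<le> card ((\<Union>g\<in>T1. ?F g) \<union> (\<Union>g\<in>T2. ?F g))"
    by (intro card_mono) auto
  also have "\<dots> \<le> card (\<Union>g\<in>T1. ?F g) + card (\<Union>g\<in>T2. ?F g)" by (rule card_Un_le)
  finally have "real (card (multiples n d)) \<le> real (card (\<Union>g\<in>T1. ?F g)) + real (card (\<Union>g\<in>T2. ?F g))"
    by linarith
  also have "real (card (\<Union>g\<in>T1. ?F g)) \<le> (9 * real d) ^ d * (2 ^ n * sqrt (2 * real d / real n) ^ d)"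
  proof (rule card_UN_real_le[OF fin(1) _ T1])
    fix g assume "g \<in> T1"
    then show "real (card (?F g)) \<le> 2 ^ n * sqrt (2 * real d / real n) ^ d"
      using assms by (intro card_sign_multiples_le_sqrt) (auto simp: T1_def S1_def monic_int_def)
  qed simp
  also have "real (card (\<Union>g\<in>T2. ?F g)) \<le> (3 * real d * 2 ^ d) ^ d * 2 ^ (n - n div d)"
  proof (rule card_UN_real_le[OF fin(2) _ T2])
    fix g assume "g \<in> T2"
    then obtain \<alpha> where \<alpha>: "poly (cpoly g) \<alpha> = 0" "cmod \<alpha> > 1 + 1 / real d"
      by (force simp: T2_def S1_def S2_def)
    \<comment> \<open>By Bernoulli's inequality the same radius is large enough for
      \<open>\<alpha> ^ d\<close> to serve as a digit base.\<close>
    have "2 \<le> (1 + 1 / real d) ^ d"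
      using Bernoulli_inequality[of "1 / real d" d] assms(1) order_trans[of "- 1" 0 "1 / real d"] by simp
    also have "\<dots> \<le> cmod \<alpha> ^ d"
      using \<alpha>(2) by (intro power_mono) auto
    finally have "real (card {\<epsilon> \<in> signs n. poly (cpoly (sign_poly n \<epsilon>)) \<alpha> = 0}) \<le> 2 ^ (n - n div d)"
      using assms(1) by (intro card_sign_root_le)
    moreover have "?F g \<subseteq> {\<epsilon> \<in> signs n. poly (cpoly (sign_poly n \<epsilon>)) \<alpha> = 0}"
      using \<alpha>(1) by (auto simp: cpoly_mult elim!: dvdE)
    then have "card (?F g) \<le> card {\<epsilon> \<in> signs n. poly (cpoly (sign_poly n \<epsilon>)) \<alpha> = 0}"
      by (rule card_mono[rotated]) simp
    ultimately show "real (card (?F g)) \<le> 2 ^ (n - n div d)" by linarith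
  qed simp
  finally have "real (card (multiples n d))
    \<le> (9 * real d) ^ d * (2 ^ n * sqrt (2 * real d / real n) ^ d) + (3 * real d * 2 ^ d) ^ d * 2 ^ (n - n div d)" by simp
  also have "(2::real) ^ (n - n div d) = 2 ^ n / 2 ^ (n div d)"
    by (rule power_diff) simp_all
  finally show ?thesis
    by (simp add: power_mult_distrib distrib_left mult_ac)
qed

text \<open>One factor \<open>x\<close> is kept to supply \<open>1 / sqrt n\<close>, and the other
  \<open>d - 1\<close> are bounded by \<open>1 / 4\<close>. The kept factor costs
  \<open>13 * d\<^sup>2\<close>, which \<open>d\<^sup>2 \<le> 2 ^ (d + 1)\<close> absorbs; the
  constant is \<open>13 * 2 * 4 = 104\<close>.\<close>

lemma power_term_le:
  fixes d n :: nat
  assumes "d > 0" "10000 * d ^ 3 \<le> n"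
  shows "(9 * real d * sqrt (2 * real d / real n)) ^ d \<le> 104 / sqrt (real n) * (1 / 2) ^ d"
proof -
  define x where "x = 9 * real d * sqrt (2 * real d / real n)"
  have n: "n > 0" using assms by (cases n) auto
  have d3: "10000 * real d ^ 3 \<le> real n"
    using of_nat_mono[OF assms(2), where ?'a = real] by simp
  have x2: "x\<^sup>2 = 162 * real d ^ 3 / real n"
    by (simp add: x_def power_mult_distrib) (simp add: power2_eq_square power3_eq_cube)
  have x0: "x \<ge> 0" by (simp add: x_def)
  have "x\<^sup>2 \<le> (1 / 4)\<^sup>2"
    unfolding x2 using d3 n by (simp add: power2_eq_square field_simps)
  then have x4: "x \<le> 1 / 4" by (rule power2_le_imp_le) simp
  have "x\<^sup>2 \<le> (13 * real d ^ 2 / sqrt (real n))\<^sup>2"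
  proof -
    \<comment> \<open>Rounding 162 up to 169 and \<open>d ^ 3\<close> up to \<open>d ^ 4\<close>
      makes the bound the square of \<open>13 * d\<^sup>2 / sqrt n\<close>.\<close>
    have "real d ^ 3 \<le> real d ^ 4" using assms(1) by (intro power_increasing) auto
    then have "162 * real d ^ 3 / real n \<le> 169 * real d ^ 4 / real n"
      using zero_le_power[of "real d" 4] by (intro divide_right_mono) linarith+
    then show ?thesis
      unfolding x2 by (simp add: power_divide power_mult_distrib)
  qed
  then have x13: "x \<le> 13 * real d ^ 2 / sqrt (real n)" by (rule power2_le_imp_le) simp
  have "d ^ 2 \<le> 2 ^ (d + 1)"
  proof (cases "d < 4")
    case True
    then have "d \<in> {0, 1, 2, 3}" by auto
    then show ?thesis by auto
  next
    case False
    then have "4 \<le> d" by simp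
    then show ?thesis
    proof (induction d rule: dec_induct)
      case (step k)
      have "4 * k \<le> k * k" using step by (intro mult_right_mono) auto
      moreover have "(Suc k)\<^sup>2 = k * k + 2 * k + 1" by (simp add: power2_eq_square)
      ultimately have "(Suc k)\<^sup>2 \<le> 2 * k ^ 2"
        using step(1) unfolding power2_eq_square by linarith
      with step(3) show ?case by simp
    qed simp
  qed
  from of_nat_mono[OF this, where ?'a = real] have d2: "real d ^ 2 \<le> 2 ^ (d + 1)"
    by simp
  have "x ^ d = x * x ^ (d - 1)" using assms(1) by (simp add: power_eq_if)
  also have "\<dots> \<le> (13 * 2 ^ (d + 1) / sqrt (real n)) * (1 / 4) ^ (d - 1)"
  proof (intro mult_mono power_mono x4 x0)
    show "x \<le> 13 * 2 ^ (d + 1) / sqrt (real n)"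
      by (rule order_trans[OF x13], intro divide_right_mono) (use d2 in auto)
  qed (use x0 in auto)
  also have "\<dots> = 104 / sqrt (real n) * (1 / 2) ^ d"
  proof -
    have "(1 / 4 :: real) ^ (d - 1) = 4 * (1 / 2) ^ d * (1 / 2) ^ d"
      using assms(1) by (cases d) (simp_all flip: power_mult_distrib)
    moreover have "(2::real) ^ d * (1 / 2) ^ d = 1"
      by (simp flip: power_mult_distrib)
    ultimately show ?thesis by (simp add: mult.assoc mult.left_commute)
  qed
  finally show ?thesis by (simp only: x_def)
qed

text \<open>Since \<open>t\<close> is at least \<open>10000 * d\<^sup>2\<close>, the power
  \<open>2 ^ t\<close> pays for the numerator, which is at most \<open>2 ^ (3 * d\<^sup>2)\<close>,
  for the decay \<open>2 ^ d\<close>, and for a reserve \<open>2 ^ s\<close> with \<open>s\<close>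
  half of \<open>t\<close>. The reserve is at least \<open>sqrt n / 2\<close>, because
  \<open>t + 1 \<ge> n / d \<ge> sqrt n\<close>.\<close>

lemma exponential_term_le:
  fixes d n :: nat
  assumes "d > 0" "10000 * d ^ 3 \<le> n"
  shows "(3 * real d * 2 ^ d) ^ d / 2 ^ (n div d) \<le> 2 / sqrt (real n) * (1 / 2 :: real) ^ d"
proof -
  define t where "t = n div d"
  define s where "s = t div 2"
  have n: "n > 0" using assms by (cases n) auto
  have "10000 * d ^ 2 * d \<le> n" using assms(2) by (simp add: power3_eq_cube power2_eq_square mult_ac)
  then have t: "10000 * d ^ 2 \<le> t"
    unfolding t_def using assms(1) by (simp add: less_eq_div_iff_mult_less_eq)
  have "d \<le> d ^ 2" using assms(1) by (simp add: power2_eq_square)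
  then have tds: "3 * (d * d) + d + s \<le> t"
    using t unfolding s_def power2_eq_square by linarith
  have 3: "3 * d \<le> 4 ^ d"
  proof (induction d)
    case (Suc d)
    have "1 \<le> (4::nat) ^ d" by simp
    with Suc have "3 * d + 3 \<le> 4 ^ d + 3 * 4 ^ d" by (intro add_mono) simp_all
    then show ?case by simp
  qed simp
  from of_nat_mono[OF this, where ?'a = real] have "3 * real d \<le> 4 ^ d" by simp
  then have "(3 * real d * 2 ^ d) ^ d \<le> (4 ^ d * 2 ^ d) ^ d"
    by (intro power_mono mult_right_mono) auto
  also have "\<dots> = (2::real) ^ (3 * (d * d))"
    by (simp add: power_mult flip: power_mult_distrib)
  finally have "(3 * real d * 2 ^ d) ^ d / 2 ^ t \<le> 2 ^ (3 * (d * d)) / 2 ^ t"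
    by (intro divide_right_mono) auto
  also have "\<dots> \<le> 2 ^ (3 * (d * d)) / 2 ^ (3 * (d * d) + d + s)"
    using tds by (intro divide_left_mono power_increasing) auto
  also have "\<dots> = (1 / 2) ^ d * (1 / 2 ^ s)"
    by (simp add: power_add power_divide)
  also have "\<dots> \<le> (1 / 2) ^ d * (2 / sqrt (real n))"
  proof (intro mult_left_mono)
    have "n < d * (t + 1)"
      unfolding t_def using assms(1) dividend_less_times_div[of d n] by (simp add: algebra_simps)
    from of_nat_mono[OF less_imp_le[OF this], where ?'a = real]
    have ndt: "real n \<le> real d * (real t + 1)" by (simp add: algebra_simps)
    have "t \<le> n" by (simp add: t_def)
    then have "d ^ 2 \<le> n" using t by linarith
    from of_nat_mono[OF this, where ?'a = real] have "real d \<le> sqrt (real n)"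
      by (intro real_le_rsqrt) simp
    then have "sqrt (real n) * sqrt (real n) \<le> sqrt (real n) * (real t + 1)"
      using order_trans[OF ndt mult_right_mono] by simp
    then have "sqrt (real n) \<le> real t + 1"
      using n by (simp only: mult_le_cancel_left_pos real_sqrt_gt_zero of_nat_0_less_iff)
    also have "real t + 1 \<le> 2 * (real s + 1)"
    proof -
      have "t + 1 \<le> 2 * (s + 1)" unfolding s_def by presburger
      then have "real (t + 1) \<le> real (2 * (s + 1))" by (rule of_nat_mono)
      then show ?thesis by simp
    qed
    also have "real s + 1 \<le> 2 ^ s"
      using of_nat_mono[OF Suc_leI[OF less_exp[of s]], where ?'a = real] by simp
    finally have "sqrt (real n) \<le> 2 * 2 ^ s" by simp
    then show "1 / 2 ^ s \<le> 2 / sqrt (real n)"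
      using n by (simp add: field_simps)
  qed simp
  finally show ?thesis by (simp add: t_def mult.commute)
qed

lemma card_low_degree_multiples_le:
  assumes "n > 0"
  shows "real (card (\<Union>d\<in>{d. d > 0 \<and> 10000 * d ^ 3 \<le> n}. multiples n d)) \<le> 2 ^ n * (212 / sqrt (real n))"
proof -
  define D where "D = {d. d > 0 \<and> 10000 * d ^ 3 \<le> n}"
  have le: "d \<le> d ^ 3" for d :: nat
    by (cases "d = 0") (auto intro: self_le_power)
  have sub: "D \<subseteq> {..n}"
  proof
    fix d assume "d \<in> D"
    then show "d \<in> {..n}" using le[of d] by (simp add: D_def)
  qed
  then have fin: "finite D" by (rule finite_subset) simp
  have "real (card (\<Union>d\<in>D. multiples n d)) \<le> real (\<Sum>d\<in>D. card (multiples n d))"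
    by (intro of_nat_mono card_UN_le fin)
  also have "\<dots> = (\<Sum>d\<in>D. real (card (multiples n d)))" by simp
  also have "\<dots> \<le> (\<Sum>d\<in>D. 2 ^ n * (106 / sqrt (real n)) * (1 / 2) ^ d)"
  proof (rule sum_mono)
    fix d assume "d \<in> D"
    then have d: "d > 0" "10000 * d ^ 3 \<le> n" by (auto simp: D_def)
    then have "2 * d \<le> n" using le[of d] by linarith
    then have "real (card (multiples n d))
        \<le> 2 ^ n * ((9 * real d * sqrt (2 * real d / real n)) ^ d + (3 * real d * 2 ^ d) ^ d / 2 ^ (n div d))"
      using d by (intro card_multiples_le)
    also have "\<dots> \<le> 2 ^ n * (104 / sqrt (real n) * (1 / 2) ^ d + 2 / sqrt (real n) * (1 / 2) ^ d)"
      using power_term_le[OF d] exponential_term_le[OF d] by (intro mult_left_mono add_mono) simp_all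
    also have "\<dots> = 2 ^ n * (106 / sqrt (real n)) * (1 / 2) ^ d"
      by (simp add: algebra_simps add_divide_distrib[symmetric])
    finally show "real (card (multiples n d)) \<le> 2 ^ n * (106 / sqrt (real n)) * (1 / 2) ^ d" .
  qed
  also have "\<dots> = 2 ^ n * (106 / sqrt (real n)) * (\<Sum>d\<in>D. (1 / 2) ^ d)"
    by (simp only: sum_distrib_left)
  also have "\<dots> \<le> 2 ^ n * (106 / sqrt (real n)) * 2"
  proof (intro mult_left_mono)
    \<comment> \<open>The larger range includes \<open>d = 0\<close>, so the geometric series is
      bounded by 2, which doubles \<open>106 = 104 + 2\<close> to 212.\<close>
    have "(\<Sum>d\<in>D. (1 / 2 :: real) ^ d) \<le> (\<Sum>d\<le>n. (1 / 2) ^ d)"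
      using sub by (intro sum_mono2) auto
    also have "\<dots> \<le> 2" by (simp add: sum_gp0)
    finally show "(\<Sum>d\<in>D. (1 / 2 :: real) ^ d) \<le> 2" .
  qed simp
  finally show ?thesis by (simp add: D_def mult_ac)
qed

section \<open>Random signs\<close>

text \<open>A Rademacher variable takes the values 1 and -1 only almost surely; this null set is
  discarded when outcomes are replaced by sign patterns.\<close>

lemma (in prob_space) prob_rademacher_other:
  assumes "rademacher X"
  shows "prob {\<omega> \<in> space M. X \<omega> \<noteq> 1 \<and> X \<omega> \<noteq> -1} = 0"
proof -
  have [measurable]: "random_variable borel X"
    using assms by (simp add: rademacher_def)
  have "prob ({\<omega> \<in> space M. X \<omega> = 1} \<union> {\<omega> \<in> space M. X \<omega> = -1})
      = prob {\<omega> \<in> space M. X \<omega> = 1} + prob {\<omega> \<in> space M. X \<omega> = -1}"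
    by (intro finite_measure_Union) auto
  also have "\<dots> = 1" using assms by (simp add: rademacher_def)
  finally have "prob (space M - ({\<omega> \<in> space M. X \<omega> = 1} \<union> {\<omega> \<in> space M. X \<omega> = -1})) = 0"
    by (subst prob_compl) auto
  moreover have "space M - ({\<omega> \<in> space M. X \<omega> = 1} \<union> {\<omega> \<in> space M. X \<omega> = -1})
      = {\<omega> \<in> space M. X \<omega> \<noteq> 1 \<and> X \<omega> \<noteq> -1}" by auto
  ultimately show ?thesis by simp
qed

lemma (in prob_space) prob_sign_pattern:
  assumes "indep_vars (\<lambda>_. borel) \<xi> UNIV" "\<And>i. rademacher (\<xi> i)"
    and "n > 0" "\<epsilon> \<in> signs n"
  shows "prob {\<omega> \<in> space M. \<forall>i<n. \<xi> i \<omega> = of_int (\<epsilon> i)} = (1 / 2) ^ n"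
proof -
  have "{\<omega> \<in> space M. \<forall>i<n. \<xi> i \<omega> = of_int (\<epsilon> i)}
      = (\<Inter>i\<in>{..<n}. \<xi> i -` {of_int (\<epsilon> i)} \<inter> space M)"
    using assms(3) by auto
  also have "prob \<dots> = (\<Prod>i<n. prob (\<xi> i -` {of_int (\<epsilon> i)} \<inter> space M))"
    using assms(3) by (intro indep_varsD[OF assms(1)]) auto
  also have "\<dots> = (\<Prod>i<n. 1 / 2)"
  proof (rule prod.cong[OF refl])
    fix i assume "i \<in> {..<n}"
    then have "\<epsilon> i \<in> {-1, 1}" using signs_mem[OF assms(4)] by simp
    moreover have "\<xi> i -` {c} \<inter> space M = {\<omega> \<in> space M. \<xi> i \<omega> = c}" for c by auto
    ultimately show "prob (\<xi> i -` {of_int (\<epsilon> i)} \<inter> space M) = 1 / 2"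
      using assms(2)[of i] by (auto simp: rademacher_def)
  qed
  finally show ?thesis by simp
qed

text \<open>Passes from probability to counting: \<open>A\<close> is covered by the null sets where
  some variable is not a sign and by one cylinder of probability \<open>(1 / 2) ^ n\<close> for each
  pattern in \<open>B\<close>.\<close>

lemma (in prob_space) prob_le_card_sign_patterns:
  fixes \<xi> :: "nat \<Rightarrow> 'a \<Rightarrow> real"
  assumes "indep_vars (\<lambda>_. borel) \<xi> UNIV" "\<And>i. rademacher (\<xi> i)"
    and "n > 0" "B \<subseteq> signs n"
    and "\<And>\<omega> \<epsilon>. \<omega> \<in> A \<Longrightarrow> \<epsilon> \<in> signs n \<Longrightarrow> (\<And>i. i < n \<Longrightarrow> \<xi> i \<omega> = of_int (\<epsilon> i)) \<Longrightarrow> \<epsilon> \<in> B"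
    and "A \<subseteq> space M"
  shows "prob A \<le> card B / 2 ^ n"
proof -
  have [measurable]: "random_variable borel (\<xi> i)" for i
    using assms(2) by (simp add: rademacher_def)
  have finB: "finite B" using assms(4) by (rule finite_subset) simp
  let ?N = "\<lambda>i. {\<omega> \<in> space M. \<xi> i \<omega> \<noteq> 1 \<and> \<xi> i \<omega> \<noteq> -1}"
  let ?P = "\<lambda>\<epsilon>. {\<omega> \<in> space M. \<forall>i<n. \<xi> i \<omega> = of_int (\<epsilon> i)}"
  have P: "?P \<epsilon> \<in> events" for \<epsilon> by measurable
  have N: "?N i \<in> events" for i by measurable
  have UP: "(\<Union>\<epsilon>\<in>B. ?P \<epsilon>) \<in> events" and UN: "(\<Union>i<n. ?N i) \<in> events"
    using finB P N by blast+
  have "A \<subseteq> (\<Union>i<n. ?N i) \<union> (\<Union>\<epsilon>\<in>B. ?P \<epsilon>)"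
  proof
    fix \<omega> assume \<omega>: "\<omega> \<in> A"
    show "\<omega> \<in> (\<Union>i<n. ?N i) \<union> (\<Union>\<epsilon>\<in>B. ?P \<epsilon>)"
    proof (cases "\<exists>i<n. \<xi> i \<omega> \<noteq> 1 \<and> \<xi> i \<omega> \<noteq> -1")
      case True
      then show ?thesis using \<omega> assms(6) by auto
    next
      case False
      define \<epsilon> where "\<epsilon> = restrict (\<lambda>i. if \<xi> i \<omega> = 1 then 1 else -1 :: int) {..<n}"
      have "\<epsilon> \<in> signs n" by (auto simp: \<epsilon>_def signs_def)
      moreover have eq: "\<xi> i \<omega> = of_int (\<epsilon> i)" if "i < n" for i
        using False that by (auto simp: \<epsilon>_def)
      ultimately have "\<epsilon> \<in> B" using assms(5)[OF \<omega>] by blast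
      then show ?thesis using eq \<omega> assms(6) by blast
    qed
  qed
  then have "prob A \<le> prob ((\<Union>i<n. ?N i) \<union> (\<Union>\<epsilon>\<in>B. ?P \<epsilon>))"
    using UN UP by (intro finite_measure_mono sets.Un)
  also have "\<dots> \<le> prob (\<Union>i<n. ?N i) + prob (\<Union>\<epsilon>\<in>B. ?P \<epsilon>)"
    by (rule measure_Un_le[OF UN UP])
  also have "\<dots> \<le> (\<Sum>i<n. prob (?N i)) + (\<Sum>\<epsilon>\<in>B. prob (?P \<epsilon>))"
    using P N finB by (intro add_mono finite_measure_subadditive_finite) blast+
  also have "(\<Sum>i<n. prob (?N i)) = 0"
    by (intro sum.neutral ballI prob_rademacher_other assms(2))
  also have "(\<Sum>\<epsilon>\<in>B. prob (?P \<epsilon>)) = (\<Sum>\<epsilon>\<in>B. (1 / 2) ^ n)"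
    using assms(4) by (intro sum.cong refl prob_sign_pattern assms(1-3)) blast
  finally show ?thesis by (simp add: power_one_over)
qed

lemma monic_poly_eq_cpoly_sign_poly:
  assumes "\<And>i. i < n \<Longrightarrow> a i = of_int (\<epsilon> i)"
  shows "monic_poly a n = cpoly (sign_poly n \<epsilon>)"
proof (rule poly_eqI)
  fix i
  have "coeff (\<Sum>i<n. monom (complex_of_real (a i)) i) i = (if i < n then of_real (a i) else 0)"
    by (simp add: coeff_sum sum.delta')
  then show "coeff (monic_poly a n) i = coeff (cpoly (sign_poly n \<epsilon>)) i"
    using assms by (simp add: monic_poly_def coeff_sign_poly)
qed

text \<open>Positivity of the degree matters: \<open>multiples n 0\<close> is all of
  \<open>signs n\<close>, since the constant 1 divides everything, but it has no root.\<close>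

lemma low_degree_root_imp_multiple:
  assumes "\<epsilon> \<in> signs n" "poly (cpoly (sign_poly n \<epsilon>)) z = 0"
  shows "\<epsilon> \<in> multiples n (algebraic_degree z)" "algebraic_degree z > 0"
proof -
  have "lead_coeff (sign_poly n \<epsilon>) = 1"
    by (simp add: degree_sign_poly coeff_sign_poly)
  then obtain g where g: "lead_coeff g = 1" "g dvd sign_poly n \<epsilon>" "degree g = algebraic_degree z"
    "poly (cpoly g) z = 0"
    using ex_monic_int_factor[OF _ assms(2)] by blast
  then show "\<epsilon> \<in> multiples n (algebraic_degree z)"
    using assms(1) unfolding multiples_def monic_int_def by blast
  show "algebraic_degree z > 0"
  proof (rule ccontr)
    assume "\<not> algebraic_degree z > 0"
    then have "degree g = 0" using g(3) by simp
    then have "g = 1" using g(1) by (auto elim!: degree_eq_zeroE)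
    then show False using g(4) by simp
  qed
qed

text \<open>From \<open>ln n \<ge> 3\<close> the logarithmic factor is at least 27, and
  \<open>27 ^ 3 = 19683\<close> exceeds 10000.\<close>

lemma degree_bound_imp_cube_le:
  assumes "real d \<le> real n powr (1 / 3) / ln (real n) ^ 3" "ln (real n) \<ge> 3" "n > 0"
  shows "10000 * d ^ 3 \<le> n"
proof -
  have "27 \<le> ln (real n) ^ 3" using power_mono[OF assms(2), of 3] by simp
  then have "real n powr (1 / 3) / ln (real n) ^ 3 \<le> real n powr (1 / 3) / 27"
    using assms(2) by (intro divide_left_mono) auto
  with assms(1) have "real d \<le> real n powr (1 / 3) / 27" by linarith
  then have "real d ^ 3 \<le> (real n powr (1 / 3) / 27) ^ 3"
    by (intro power_mono) auto
  also have "\<dots> = real n / 19683"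
    using assms(3) by (simp add: power_divide powr_powr flip: powr_realpow)
  finally have "10000 * real d ^ 3 \<le> real n" by simp
  then have "real (10000 * d ^ 3) \<le> real n" by simp
  then show ?thesis by (simp only: of_nat_le_iff)
qed

theorem theorem2p1:
  fixes M :: "'a measure" and \<xi> :: "nat \<Rightarrow> 'a \<Rightarrow> real"
  assumes "prob_space M"
    and "prob_space.indep_vars M (\<lambda>_. borel) \<xi> UNIV"
    and "\<And>i. prob_space.rademacher M (\<xi> i)"
  shows "(\<lambda>n. measure M {\<omega> \<in> space M. \<exists>z :: complex.
            poly (monic_poly (\<lambda>i. \<xi> i \<omega>) n) z = 0 \<and> algebraic z \<and>
            real (algebraic_degree z) \<le> real n powr (1 / 3) / ln (real n) ^ 3})
         \<in> O(\<lambda>n. 1 / sqrt (real n))"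
proof (rule bigoI)
  interpret prob_space M by fact
  have "filterlim (\<lambda>n. ln (real n)) at_top at_top"
    by (rule filterlim_compose[OF ln_at_top filterlim_real_sequentially])
  then have "\<forall>\<^sub>F n in at_top. 3 \<le> ln (real n)"
    by (simp add: filterlim_at_top)
  moreover have "\<forall>\<^sub>F n in at_top. (0::nat) < n" by (rule eventually_gt_at_top)
  ultimately show "\<forall>\<^sub>F n in at_top. norm (measure M {\<omega> \<in> space M. \<exists>z :: complex.
            poly (monic_poly (\<lambda>i. \<xi> i \<omega>) n) z = 0 \<and> algebraic z \<and>
            real (algebraic_degree z) \<le> real n powr (1 / 3) / ln (real n) ^ 3})
         \<le> 212 * norm (1 / sqrt (real n))"
  proof eventually_elim
    case (elim n)
    define B where "B = (\<Union>d\<in>{d. d > 0 \<and> 10000 * d ^ 3 \<le> n}. multiples n d)"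
    let ?A = "{\<omega> \<in> space M. \<exists>z :: complex.
            poly (monic_poly (\<lambda>i. \<xi> i \<omega>) n) z = 0 \<and> algebraic z \<and>
            real (algebraic_degree z) \<le> real n powr (1 / 3) / ln (real n) ^ 3}"
    have "prob ?A \<le> card B / 2 ^ n"
    proof (rule prob_le_card_sign_patterns[OF assms(2,3) elim(2)])
      show "B \<subseteq> signs n" by (auto simp: B_def multiples_def)
    next
      fix \<omega> \<epsilon>
      assume \<omega>: "\<omega> \<in> ?A" and \<epsilon>: "\<epsilon> \<in> signs n" "\<And>i. i < n \<Longrightarrow> \<xi> i \<omega> = of_int (\<epsilon> i)"
      from \<omega> obtain z where z: "poly (monic_poly (\<lambda>i. \<xi> i \<omega>) n) z = 0"
        "real (algebraic_degree z) \<le> real n powr (1 / 3) / ln (real n) ^ 3" by blast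
      have "poly (cpoly (sign_poly n \<epsilon>)) z = 0"
        using z(1) monic_poly_eq_cpoly_sign_poly[of n "\<lambda>i. \<xi> i \<omega>" \<epsilon>] \<epsilon>(2) by simp
      then show "\<epsilon> \<in> B"
        using low_degree_root_imp_multiple[OF \<epsilon>(1)] degree_bound_imp_cube_le[OF z(2) elim]
        unfolding B_def by blast
    qed auto
    also have "\<dots> \<le> 2 ^ n * (212 / sqrt (real n)) / 2 ^ n"
      unfolding B_def by (intro divide_right_mono card_low_degree_multiples_le elim) simp
    finally show ?case by simp
  qed
qed

end
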